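(* Let $d\ge 3$ and let $S=(S_t:t\ge 0)$ be a subordinator with Laplace exponent $\phi$ such that its Lévy measure and its potential measure both have decreasing densities with respect to Lebesgue measure on $(0,\infty)$. Assume that for some $\alpha\in[0,1)$ $$\lim_{\lambda\to+\infty}\frac{\phi'(\lambda x)}{\phi'(\lambda)}=x^{\frac{\alpha}{2}-1}\quad\text{for every }x>0 .$$ Let $X$ be the corresponding subordinate Brownian motion in $\mathbb{R}^d$. Then there is a constant $c>0$ such that for every $r\in(0,1)$ and every $x\in B_{r/4}(0)$ $$\mathbb{P}_x\Big(X_{\tau_{B_{r/2}(0)}}\in B_r(0)\setminus B_{r/2}(0)\Big)\le c\,\frac{r^{-2}\phi'(r^{-2})}{\phi(r^{-2})} .$$
   Context: A subordinator is a Lévy process $S$ in $\mathbb{R}$ with $S_0=0$ and values in $[0,\infty)$; its Laplace exponent $\phi$ is given by $\mathbb{E}e^{-\lambda S_t}=e^{-t\phi(\lambda)}$, $\lambda>0$, and has the form $\phi(\lambda)=\gamma\lambda+\int_{(0,\infty)}(1-e^{-\lambda t})\,\mu(dt)$ with $\gamma\ge0$ and Lévy measure $\mu$, $\int_{(0,\infty)}(1\wedge t)\,\mu(dt)<\infty$. The potential measure of $S$ is $U(A)=\mathbb{E}\int_0^\infty \mathbf{1}_{\{S_t\in A\}}\,dt$ for measurable $A\subset[0,\infty)$. "Decreasing" is meant in the non-strict sense. Let $B$ be a Brownian motion in $\mathbb{R}^d$ independent of $S$, with transition density $(4\pi t)^{-d/2}\exp(-|x-y|^2/(4t))$. The subordinate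 Brownian motion is $X_t=B(S_t)$; $\mathbb{P}_x$ denotes probability when $X$ starts at $x\in\mathbb{R}^d$. $B_r(x)$ is the open Euclidean ball with center $x$ and radius $r$, and $\tau_D=\inf\{t>0: X_t\notin D\}$ for an open set $D$. *)

theory Defs
  imports "HOL-Probability.Probability"
begin

definition cadlag :: "(real \<Rightarrow> 'b::topological_space) \<Rightarrow> bool" where
  "cadlag f \<longleftrightarrow> (\<forall>t\<ge>0. (f \<longlongrightarrow> f t) (at_right t)) \<and> (\<forall>t>0. \<exists>l. (f \<longlongrightarrow> l) (at_left t))"

text \<open>A process is a map \<open>X :: real \<Rightarrow> 'w \<Rightarrow> 'b\<close>, of which only the times \<open>t \<ge> 0\<close> matter.
  Path properties are required almost surely. Stochastic continuity is not listed, since it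
  follows from right-continuity of the paths and stationarity of the increments.\<close>

definition levy_process :: "'w measure \<Rightarrow> (real \<Rightarrow> 'w \<Rightarrow> 'b::euclidean_space) \<Rightarrow> bool" where
  "levy_process M X \<longleftrightarrow>
     prob_space M \<and>
     (\<forall>t\<ge>0. X t \<in> borel_measurable M) \<and>
     (AE \<omega> in M. X 0 \<omega> = 0) \<and>
     (\<forall>n t. 0 \<le> t 0 \<and> (\<forall>i<n. t i \<le> t (Suc i)) \<longrightarrow>
        prob_space.indep_vars M (\<lambda>_. borel) (\<lambda>i \<omega>. X (t (Suc i)) \<omega> - X (t i) \<omega>) {..<n::nat}) \<and>
     (\<forall>s\<ge>0. \<forall>t\<ge>0. distr M borel (\<lambda>\<omega>. X (s + t) \<omega> - X s \<omega>) = distr M borel (X t)) \<and>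
     (AE \<omega> in M. cadlag (\<lambda>t. X t \<omega>))"

definition subordinator :: "'w measure \<Rightarrow> (real \<Rightarrow> 'w \<Rightarrow> real) \<Rightarrow> bool" where
  "subordinator M S \<longleftrightarrow> levy_process M S \<and> (AE \<omega> in M. \<forall>t\<ge>0. 0 \<le> S t \<omega>)"

text \<open>The values of \<open>\<phi>\<close> outside \<open>(0, \<infinity>)\<close> are irrelevant.\<close>

definition laplace_exponent :: "'w measure \<Rightarrow> (real \<Rightarrow> 'w \<Rightarrow> real) \<Rightarrow> (real \<Rightarrow> real) \<Rightarrow> bool" where
  "laplace_exponent M S \<phi> \<longleftrightarrow>
     (\<forall>t\<ge>0. \<forall>l>0. (\<integral>\<omega>. exp (- l * S t \<omega>) \<partial>M) = exp (- t * \<phi> l))"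

text \<open>\<open>\<gamma>\<close> and \<open>\<mu>\<close> are the drift and the Levy measure belonging to \<open>\<phi>\<close>. A measure on \<open>(0, \<infinity>)\<close>
  is encoded as a Borel measure on the line that does not charge \<open>(-\<infinity>, 0]\<close>.\<close>

definition drift_and_levy_measure :: "(real \<Rightarrow> real) \<Rightarrow> real \<Rightarrow> real measure \<Rightarrow> bool" where
  "drift_and_levy_measure \<phi> \<gamma> \<mu> \<longleftrightarrow>
     0 \<le> \<gamma> \<and>
     sets \<mu> = sets borel \<and> emeasure \<mu> {..0} = 0 \<and>
     (\<integral>\<^sup>+ t. ennreal (min 1 t) \<partial>\<mu>) < \<infinity> \<and>
     (\<forall>l>0. \<phi> l = \<gamma> * l + (\<integral>t. (1 - exp (- l * t)) \<partial>\<mu>))"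

definition potential :: "'w measure \<Rightarrow> (real \<Rightarrow> 'w \<Rightarrow> real) \<Rightarrow> real set \<Rightarrow> ennreal" where
  "potential M S A = (\<integral>\<^sup>+ \<omega>. (\<integral>\<^sup>+ t\<in>{0..}. indicator A (S t \<omega>) \<partial>lborel) \<partial>M)"

text \<open>\<open>\<nu>\<close> is given as a set function on the Borel sets. All its mass is described by the density:
  in particular \<open>\<nu>\<close> has no atom at \<open>0\<close>.\<close>

definition has_decreasing_density :: "(real set \<Rightarrow> ennreal) \<Rightarrow> bool" where
  "has_decreasing_density \<nu> \<longleftrightarrow>
     (\<exists>f::real \<Rightarrow> real. (\<forall>t>0. 0 \<le> f t) \<and> antimono_on {0<..} f \<and>
        (\<forall>A\<in>sets borel. \<nu> A = (\<integral>\<^sup>+ t\<in>A \<inter> {0<..}. ennreal (f t) \<partial>lborel)))"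

text \<open>The normalisation is that of the generator \<open>\<Delta>\<close>, not \<open>\<Delta>/2\<close>. The motion starts at \<open>0\<close>; by
  stationarity and independence of the increments the density of \<open>B t\<close> is the transition density.\<close>

definition brownian_motion :: "'w measure \<Rightarrow> (real \<Rightarrow> 'w \<Rightarrow> 'b::euclidean_space) \<Rightarrow> bool" where
  "brownian_motion M B \<longleftrightarrow>
     levy_process M B \<and>
     (AE \<omega> in M. continuous_on {0..} (\<lambda>t. B t \<omega>)) \<and>
     (\<forall>t>0. distributed M lborel (B t)
        (\<lambda>y. ennreal ((4 * pi * t) powr (- real DIM('b) / 2) * exp (- (norm y)\<^sup>2 / (4 * t)))))"

definition path_events :: "'w measure \<Rightarrow> (real \<Rightarrow> 'w \<Rightarrow> 'b::topological_space) \<Rightarrow> 'w set set" where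
  "path_events M X =
     {(\<lambda>\<omega>. \<lambda>t\<in>{0..}. X t \<omega>) -` A \<inter> space M | A. A \<in> sets (Pi\<^sub>M {0..} (\<lambda>_. borel))}"

definition indep_processes ::
  "'w measure \<Rightarrow> (real \<Rightarrow> 'w \<Rightarrow> 'b::topological_space) \<Rightarrow> (real \<Rightarrow> 'w \<Rightarrow> 'c::topological_space) \<Rightarrow> bool" where
  "indep_processes M X Y \<longleftrightarrow> prob_space.indep_set M (path_events M X) (path_events M Y)"

text \<open>Subordinate Brownian motion started at \<open>x\<close>: its law under the reference measure is that of
  \<open>X\<close> under \<open>P\<^sub>x\<close>.\<close>

definition subordinate_bm ::
  "(real \<Rightarrow> 'w \<Rightarrow> 'b::euclidean_space) \<Rightarrow> (real \<Rightarrow> 'w \<Rightarrow> real) \<Rightarrow> 'b \<Rightarrow> real \<Rightarrow> 'w \<Rightarrow> 'b" where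
  "subordinate_bm B S x t \<omega> = x + B (S t \<omega>) \<omega>"

definition exit_time :: "(real \<Rightarrow> 'w \<Rightarrow> 'b) \<Rightarrow> 'b set \<Rightarrow> 'w \<Rightarrow> ereal" where
  "exit_time X D \<omega> = Inf {ereal t | t. 0 < t \<and> X t \<omega> \<notin> D}"

text \<open>The probability that the process leaves \<open>D\<close> and is in \<open>A\<close> at the exit time. The completion is
  taken because exit times of cadlag processes are in general measurable only up to null sets.\<close>

definition exit_prob :: "'w measure \<Rightarrow> (real \<Rightarrow> 'w \<Rightarrow> 'b) \<Rightarrow> 'b set \<Rightarrow> 'b set \<Rightarrow> real" where
  "exit_prob M X D A = measure (completion M)
     {\<omega> \<in> space M. exit_time X D \<omega> < \<infinity> \<and> X (real_of_ereal (exit_time X D \<omega>)) \<omega> \<in> A}"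

end

theory Submission
  imports Defs
begin

text \<open>The bound is already true for the probability that \<open>X\<close> ever hits the annulus, so neither the
  Ikeda-Watanabe formula nor an estimate of the jump kernel is needed. Let \<open>f\<close> be the indicator of a
  slightly larger annulus that still has distance \<open>r / 8\<close> from the ball of radius \<open>r / 4\<close>, and let
  \<open>Uf(z)\<close> be the expected time that \<open>z + X\<close> spends there. \<open>Uf\<close> is excessive, so the probability of
  hitting the annulus from \<open>x\<close> is at most \<open>Uf(x)\<close> divided by the infimum of \<open>Uf\<close> on the annulus.
  With \<open>u\<close> the decreasing density of the potential measure, \<open>Uf(z)\<close> is the integral of
  \<open>P(B_s + z \<in> shell) u(s)\<close> over \<open>s > 0\<close>. The Laplace transform of \<open>u\<close> is \<open>1/\<phi>\<close>, which bounds the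
  infimum from below by a multiple of \<open>1/\<phi>(1/r^2)\<close>. The derivative of \<open>1/\<phi>\<close> gives the integral of
  \<open>s exp(-s/r^2) u(s)\<close> as \<open>\<phi>'/\<phi>^2\<close> at \<open>1/r^2\<close>; this controls the times \<open>s \<le> r^2\<close>, where the Gaussian
  probability is of order \<open>s/r^2\<close>, and, as \<open>u\<close> decreases, also the times \<open>s \<ge> r^2\<close>, where it is of
  order \<open>(r^2/s)^(d/2)\<close>, which is integrable for \<open>d \<ge> 3\<close>.\<close>

section \<open>Random walks and excessive functions\<close>

text \<open>Independence makes the joint law a product measure, so Tonelli separates the two
  variables. The first variable is integrated on the inside, with its own sample point.\<close>

lemma (in prob_space) indep_var_nn_integral:
  assumes "indep_var S X T Y" and F: "F \<in> borel_measurable (S \<Otimes>\<^sub>M T)"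
  shows "(\<integral>\<^sup>+\<omega>. F (X \<omega>, Y \<omega>) \<partial>M) = (\<integral>\<^sup>+\<omega>. \<integral>\<^sup>+\<omega>'. F (X \<omega>', Y \<omega>) \<partial>M \<partial>M)"
proof -
  have [measurable]: "X \<in> measurable M S" "Y \<in> measurable M T" "F \<in> borel_measurable (S \<Otimes>\<^sub>M T)"
    and eq: "distr M S X \<Otimes>\<^sub>M distr M T Y = distr M (S \<Otimes>\<^sub>M T) (\<lambda>x. (X x, Y x))"
    using assms by (auto simp: indep_var_distribution_eq)
  interpret SX: prob_space "distr M S X" by (rule prob_space_distr) measurable
  interpret TY: prob_space "distr M T Y" by (rule prob_space_distr) measurable
  interpret P: pair_prob_space "distr M S X" "distr M T Y" ..
  have "(\<integral>\<^sup>+\<omega>. F (X \<omega>, Y \<omega>) \<partial>M) = (\<integral>\<^sup>+p. F p \<partial>(distr M S X \<Otimes>\<^sub>M distr M T Y))"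
    unfolding eq by (simp add: nn_integral_distr)
  also have "\<dots> = (\<integral>\<^sup>+y. \<integral>\<^sup>+x. F (x, y) \<partial>distr M S X \<partial>distr M T Y)"
    by (rule P.nn_integral_snd[symmetric]) measurable
  also have "\<dots> = (\<integral>\<^sup>+\<omega>. \<integral>\<^sup>+x. F (x, Y \<omega>) \<partial>distr M S X \<partial>M)"
    by (rule nn_integral_distr) measurable
  also have "\<dots> = (\<integral>\<^sup>+\<omega>. \<integral>\<^sup>+\<omega>'. F (X \<omega>', Y \<omega>) \<partial>M \<partial>M)"
    by (intro nn_integral_cong nn_integral_distr) (auto simp: measurable_space)
  finally show ?thesis .
qed

text \<open>Optional stopping for the supermartingale \<open>v (Z k)\<close> at the first visit to
  \<open>A\<close>, carried out by induction instead of with stopping times. At every step,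
  \<open>\<iota>\<close> times the probability of having hit so far plus the expectation of
  \<open>v (Z k)\<close> on the event of not having hit is at most \<open>v x\<close>.\<close>

lemma (in prob_space) excessive_hitting_bound:
  fixes Y :: "nat \<Rightarrow> 'a \<Rightarrow> 'b::euclidean_space" and v :: "'b \<Rightarrow> ennreal"
  assumes Y: "indep_vars (\<lambda>_. borel) Y {..<n}"
    and v[measurable]: "v \<in> borel_measurable borel" and A[measurable]: "A \<in> sets borel"
    and excessive: "\<And>i z. i < n \<Longrightarrow> (\<integral>\<^sup>+\<omega>. v (z + Y i \<omega>) \<partial>M) \<le> v z"
    and lower: "\<And>z. z \<in> A \<Longrightarrow> \<iota> \<le> v z"
  shows "\<iota> * emeasure M {\<omega>\<in>space M. \<exists>k\<le>n. x + (\<Sum>i<k. Y i \<omega>) \<in> A} \<le> v x"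
proof -
  have rv: "i < n \<Longrightarrow> Y i \<in> borel_measurable M" for i
    using Y by (auto simp: indep_vars_def)
  define Z where "Z k \<omega> = x + (\<Sum>i<k. Y i \<omega>)" for k \<omega>
  define N where "N k \<omega> = (\<forall>j\<le>k. Z j \<omega> \<notin> A)" for k \<omega>
  have Zm: "Z k \<in> borel_measurable M" if "k \<le> n" for k
    unfolding Z_def using that by (intro borel_measurable_add borel_measurable_sum rv) auto
  have Nm: "Measurable.pred M (N k)" if "k \<le> n" for k
  proof -
    have "Measurable.pred M (\<lambda>\<omega>. \<forall>j\<in>{..k}. Z j \<omega> \<notin> A)"
    proof (intro pred_intros_finite)
      fix j assume "j \<in> {..k}"
      then have "Z j \<in> borel_measurable M" using that by (intro Zm) auto
      then show "Measurable.pred M (\<lambda>\<omega>. Z j \<omega> \<notin> A)" by measurable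
    qed simp
    moreover have "N k = (\<lambda>\<omega>. \<forall>j\<in>{..k}. Z j \<omega> \<notin> A)"
      by (rule ext) (simp add: N_def Ball_def)
    ultimately show ?thesis by (simp only:)
  qed
  have "\<iota> * emeasure M {\<omega>\<in>space M. \<not> N k \<omega>} + (\<integral>\<^sup>+\<omega>. v (Z k \<omega>) * indicator {\<omega>. N k \<omega>} \<omega> \<partial>M) \<le> v x"
    if "k \<le> n" for k using that
  proof (induction k)
    case 0
    show ?case
    proof (cases "x \<in> A")
      case True
      then show ?thesis using lower[OF True] by (simp add: N_def Z_def emeasure_space_1)
    next
      case False
      then show ?thesis by (simp add: N_def Z_def emeasure_space_1)
    qed
  next
    case (Suc k)
    then have k: "k < n" "k \<le> n" and [measurable]: "Y k \<in> borel_measurable M" using rv by auto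
    have [measurable]: "Z k \<in> borel_measurable M" "Z (Suc k) \<in> borel_measurable M"
      "Measurable.pred M (N k)" "Measurable.pred M (N (Suc k))"
      using k by (auto intro!: Zm Nm)
    have NS: "N (Suc k) \<omega> \<longleftrightarrow> N k \<omega> \<and> Z (Suc k) \<omega> \<notin> A" for \<omega>
      by (auto simp: N_def le_Suc_eq)
    \<comment> \<open>\<open>W\<close> computes the position after \<open>k\<close> steps and the
      flag of not having hit from the first \<open>k\<close> increments alone, so the pair is
      independent of \<open>Y k\<close>.\<close>
    define W :: "(nat \<Rightarrow> 'b) \<Rightarrow> 'b \<times> bool" where
      "W y = (x + (\<Sum>i<k. y i), \<forall>j\<le>k. x + (\<Sum>i<j. y i) \<notin> A)" for y
    have Wm: "W \<in> measurable (Pi\<^sub>M {..<k} (\<lambda>_. borel)) (borel \<Otimes>\<^sub>M count_space UNIV)"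
      unfolding W_def by measurable
    have "indep_var (Pi\<^sub>M {k} (\<lambda>_. borel)) (\<lambda>\<omega>. \<lambda>i\<in>{k}. Y i \<omega>)
        (Pi\<^sub>M {..<k} (\<lambda>_. borel)) (\<lambda>\<omega>. \<lambda>i\<in>{..<k}. Y i \<omega>)"
      using k by (intro indep_var_restrict[OF Y]) auto
    \<comment> \<open>\<open>indep_var\<close> wants both variables in the same type, hence the idle flag \<open>True\<close>.\<close>
    then have "indep_var (borel \<Otimes>\<^sub>M count_space UNIV) ((\<lambda>y. (y k, True)) \<circ> (\<lambda>\<omega>. \<lambda>i\<in>{k}. Y i \<omega>))
        (borel \<Otimes>\<^sub>M count_space UNIV) (W \<circ> (\<lambda>\<omega>. \<lambda>i\<in>{..<k}. Y i \<omega>))"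
      by (rule indep_var_compose[OF _ _ Wm]) measurable
    also have "W \<circ> (\<lambda>\<omega>. \<lambda>i\<in>{..<k}. Y i \<omega>) = (\<lambda>\<omega>. (Z k \<omega>, N k \<omega>))"
      by (auto simp: W_def Z_def N_def fun_eq_iff intro!: sum.cong)
    also have "(\<lambda>y. (y k, True)) \<circ> (\<lambda>\<omega>. \<lambda>i\<in>{k}. Y i \<omega>) = (\<lambda>\<omega>. (Y k \<omega>, True))"
      by (auto simp: fun_eq_iff)
    finally have ind: "indep_var (borel \<Otimes>\<^sub>M count_space UNIV) (\<lambda>\<omega>. (Y k \<omega>, True))
      (borel \<Otimes>\<^sub>M count_space UNIV) (\<lambda>\<omega>. (Z k \<omega>, N k \<omega>))" .
    define F :: "('b \<times> bool) \<times> ('b \<times> bool) \<Rightarrow> ennreal" where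
      "F p = v (fst (snd p) + fst (fst p)) * indicator {q. snd (snd q)} p" for p
    have F: "F \<in> borel_measurable ((borel \<Otimes>\<^sub>M count_space UNIV) \<Otimes>\<^sub>M (borel \<Otimes>\<^sub>M count_space UNIV))"
      unfolding F_def by measurable
    have ZS: "Z (Suc k) \<omega> = Z k \<omega> + Y k \<omega>" for \<omega>
      by (simp add: Z_def add_ac)
    have "(\<integral>\<^sup>+\<omega>. v (Z (Suc k) \<omega>) * indicator {\<omega>. N k \<omega>} \<omega> \<partial>M)
        = (\<integral>\<^sup>+\<omega>. F ((Y k \<omega>, True), (Z k \<omega>, N k \<omega>)) \<partial>M)"
      by (simp add: F_def ZS indicator_def)
    also have "\<dots> = (\<integral>\<^sup>+\<omega>. \<integral>\<^sup>+\<omega>'. F ((Y k \<omega>', True), (Z k \<omega>, N k \<omega>)) \<partial>M \<partial>M)"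
      by (rule indep_var_nn_integral[OF ind F])
    also have "\<dots> = (\<integral>\<^sup>+\<omega>. (\<integral>\<^sup>+\<omega>'. v (Z k \<omega> + Y k \<omega>') \<partial>M) * indicator {\<omega>. N k \<omega>} \<omega> \<partial>M)"
      by (intro nn_integral_cong) (simp add: F_def indicator_def)
    also have "\<dots> \<le> (\<integral>\<^sup>+\<omega>. v (Z k \<omega>) * indicator {\<omega>. N k \<omega>} \<omega> \<partial>M)"
      using k by (intro nn_integral_mono mult_right_mono excessive) auto
    finally have step: "(\<integral>\<^sup>+\<omega>. v (Z (Suc k) \<omega>) * indicator {\<omega>. N k \<omega>} \<omega> \<partial>M)
        \<le> (\<integral>\<^sup>+\<omega>. v (Z k \<omega>) * indicator {\<omega>. N k \<omega>} \<omega> \<partial>M)" .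
    let ?H = "{\<omega>\<in>space M. N k \<omega> \<and> Z (Suc k) \<omega> \<in> A}"
    have "\<iota> * emeasure M {\<omega>\<in>space M. \<not> N (Suc k) \<omega>}
        = \<iota> * emeasure M ({\<omega>\<in>space M. \<not> N k \<omega>} \<union> ?H)"
      by (intro arg_cong[where f="\<lambda>A. \<iota> * emeasure M A"]) (auto simp: NS)
    also have "\<dots> = \<iota> * emeasure M {\<omega>\<in>space M. \<not> N k \<omega>} + \<iota> * emeasure M ?H"
      by (subst plus_emeasure[symmetric]) (auto simp: distrib_left)
    finally have 1: "\<iota> * emeasure M {\<omega>\<in>space M. \<not> N (Suc k) \<omega>} =
        \<iota> * emeasure M {\<omega>\<in>space M. \<not> N k \<omega>} + \<iota> * emeasure M ?H" .
    have "\<iota> * emeasure M ?H + (\<integral>\<^sup>+\<omega>. v (Z (Suc k) \<omega>) * indicator {\<omega>. N (Suc k) \<omega>} \<omega> \<partial>M)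
        = (\<integral>\<^sup>+\<omega>. \<iota> * indicator ?H \<omega> + v (Z (Suc k) \<omega>) * indicator {\<omega>. N (Suc k) \<omega>} \<omega> \<partial>M)"
      by (subst nn_integral_add) (auto simp: nn_integral_cmult_indicator)
    \<comment> \<open>A path that has avoided \<open>A\<close> up to step \<open>k\<close> either
      enters it now, where \<open>\<iota>\<close> is at most \<open>v (Z (Suc k))\<close> by
      \<open>lower\<close>, or continues to avoid it and keeps its value of
      \<open>v\<close>.\<close>
    also have "\<dots> \<le> (\<integral>\<^sup>+\<omega>. v (Z (Suc k) \<omega>) * indicator {\<omega>. N k \<omega>} \<omega> \<partial>M)"
      by (intro nn_integral_mono) (auto simp: NS indicator_def lower)
    also note step
    finally have "\<iota> * emeasure M ?H + (\<integral>\<^sup>+\<omega>. v (Z (Suc k) \<omega>) * indicator {\<omega>. N (Suc k) \<omega>} \<omega> \<partial>M)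
        \<le> (\<integral>\<^sup>+\<omega>. v (Z k \<omega>) * indicator {\<omega>. N k \<omega>} \<omega> \<partial>M)" .
    then have "\<iota> * emeasure M {\<omega>\<in>space M. \<not> N (Suc k) \<omega>}
          + (\<integral>\<^sup>+\<omega>. v (Z (Suc k) \<omega>) * indicator {\<omega>. N (Suc k) \<omega>} \<omega> \<partial>M)
        \<le> \<iota> * emeasure M {\<omega>\<in>space M. \<not> N k \<omega>} + (\<integral>\<^sup>+\<omega>. v (Z k \<omega>) * indicator {\<omega>. N k \<omega>} \<omega> \<partial>M)"
      unfolding 1 add.assoc by (rule add_left_mono)
    also have "\<dots> \<le> v x" using Suc by simp
    finally show ?case .
  qed
  from this[of n]
  have "\<iota> * emeasure M {\<omega>\<in>space M. \<not> N n \<omega>} \<le> v x"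
    by (meson add_increasing2 order_trans order_refl zero_le)
  also have "{\<omega>\<in>space M. \<not> N n \<omega>} = {\<omega>\<in>space M. \<exists>k\<le>n. x + (\<Sum>i<k. Y i \<omega>) \<in> A}"
    by (auto simp: N_def Z_def)
  finally show ?thesis .
qed

text \<open>Factorisation applied to indicators gives the joint law on boxes, and the boxes
  determine it as the product of the marginal laws. This converse direction yields independence for
  the increments of the subordinate process.\<close>

lemma (in prob_space) indep_varsI_nn_integral:
  fixes Y :: "nat \<Rightarrow> 'a \<Rightarrow> 'b::euclidean_space"
  assumes rv: "\<And>i. i < n \<Longrightarrow> Y i \<in> borel_measurable M"
    and prod: "\<And>G. (\<And>i. i < n \<Longrightarrow> G i \<in> borel_measurable borel) \<Longrightarrow>
      (\<integral>\<^sup>+\<omega>. (\<Prod>i<n. (G i (Y i \<omega>) :: ennreal)) \<partial>M) = (\<Prod>i<n. \<integral>\<^sup>+\<omega>. G i (Y i \<omega>) \<partial>M)"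
  shows "indep_vars (\<lambda>_. borel) Y {..<n}"
proof (cases "n = 0")
  case True
  then show ?thesis by (simp add: indep_vars_def indep_sets_def)
next
  case False
  \<comment> \<open>A product of sigma-finite measures needs a measure at every natural index, while
    \<open>Y i\<close> is a random variable only for \<open>i < n\<close>. The other indices repeat
    the law of \<open>Y 0\<close>, which is available because \<open>n\<close> is not zero.\<close>
  let ?N = "\<lambda>i. distr M borel (Y (if i < n then i else 0))"
  let ?Y = "\<lambda>\<omega>. \<lambda>i\<in>{..<n}. Y i \<omega>"
  have Ym: "?Y \<in> measurable M (Pi\<^sub>M {..<n} (\<lambda>_. borel))"
    using rv by (intro measurable_restrict) auto
  interpret N: prob_space "?N i" for i
    using False by (intro prob_space_distr rv) auto
  interpret P: product_sigma_finite ?N ..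
  have "distr M (Pi\<^sub>M {..<n} (\<lambda>_. borel)) ?Y = Pi\<^sub>M {..<n} ?N"
  proof (rule P.PiM_eqI)
    show "sets (distr M (Pi\<^sub>M {..<n} (\<lambda>_. borel)) ?Y) = sets (Pi\<^sub>M {..<n} ?N)"
      by (simp cong: sets_PiM_cong)
    fix A assume A: "\<And>i. i \<in> {..<n} \<Longrightarrow> A i \<in> sets (?N i)"
    have "emeasure (distr M (Pi\<^sub>M {..<n} (\<lambda>_. borel)) ?Y) (Pi\<^sub>E {..<n} A)
        = emeasure M (?Y -` (Pi\<^sub>E {..<n} A) \<inter> space M)"
      using A by (intro emeasure_distr Ym sets_PiM_I_finite) auto
    also have "\<dots> = (\<integral>\<^sup>+\<omega>. indicator (?Y -` (Pi\<^sub>E {..<n} A) \<inter> space M) \<omega> \<partial>M)"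
      using A by (intro nn_integral_indicator[symmetric] measurable_sets[OF Ym] sets_PiM_I_finite) auto
    also have "\<dots> = (\<integral>\<^sup>+\<omega>. (\<Prod>i<n. indicator (A i) (Y i \<omega>)) \<partial>M)"
    proof (intro nn_integral_cong)
      fix \<omega> assume "\<omega> \<in> space M"
      then show "indicator (?Y -` (Pi\<^sub>E {..<n} A) \<inter> space M) \<omega>
          = (\<Prod>i<n. indicator (A i) (Y i \<omega>) :: ennreal)"
        by (simp add: indicator_def of_bool_conj PiE_iff if_distrib prod.If_cases Ball_def Bex_def)
    qed
    also have "\<dots> = (\<Prod>i<n. \<integral>\<^sup>+\<omega>. indicator (A i) (Y i \<omega>) \<partial>M)"
      using A by (intro prod) auto
    also have "\<dots> = (\<Prod>i<n. emeasure (?N i) (A i))"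
    proof (intro prod.cong refl)
      fix i assume "i \<in> {..<n}"
      then have i: "i < n" and [measurable]: "A i \<in> sets borel" "Y i \<in> borel_measurable M"
        using A rv by auto
      have "emeasure (?N i) (A i) = (\<integral>\<^sup>+y. indicator (A i) y \<partial>?N i)"
        by (simp add: i)
      also have "\<dots> = (\<integral>\<^sup>+\<omega>. indicator (A i) (Y i \<omega>) \<partial>M)"
        using i by (subst nn_integral_distr) auto
      finally show "(\<integral>\<^sup>+\<omega>. indicator (A i) (Y i \<omega>) \<partial>M) = emeasure (?N i) (A i)" ..
    qed
    finally show "emeasure (distr M (Pi\<^sub>M {..<n} (\<lambda>_. borel)) ?Y) (Pi\<^sub>E {..<n} A)
        = (\<Prod>i<n. emeasure (?N i) (A i))" .
  qed simp
  also have "\<dots> = Pi\<^sub>M {..<n} (\<lambda>i. distr M borel (Y i))"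
    by (intro PiM_cong) auto
  finally show ?thesis
    using False rv by (subst indep_vars_iff_distr_eq_PiM') auto
qed

section \<open>Versions of processes with measurable paths\<close>

text \<open>The \<open>+ 1\<close> makes the grid point strictly larger than \<open>t\<close>, also
  when \<open>t\<close> lies on the grid. Thus the points approach \<open>t\<close> within
  \<open>at_right t\<close>, where right-continuity applies.\<close>

definition dyadic_above :: "nat \<Rightarrow> real \<Rightarrow> real" where
  "dyadic_above n t = real (nat \<lfloor>t * 2 ^ n\<rfloor> + 1) / 2 ^ n"

lemma dyadic_above_bounds:
  assumes "0 \<le> t"
  shows "t < dyadic_above n t" "dyadic_above n t \<le> t + 1 / 2 ^ n"
proof -
  have "0 \<le> t * 2 ^ n" using assms by simp
  then have "real (nat \<lfloor>t * 2 ^ n\<rfloor>) = of_int \<lfloor>t * 2 ^ n\<rfloor>" by simp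
  then have "t * 2 ^ n < real (nat \<lfloor>t * 2 ^ n\<rfloor> + 1)" "real (nat \<lfloor>t * 2 ^ n\<rfloor> + 1) \<le> t * 2 ^ n + 1"
    unfolding of_nat_add by linarith+
  then show "t < dyadic_above n t" "dyadic_above n t \<le> t + 1 / 2 ^ n"
    by (auto simp: dyadic_above_def field_simps)
qed

lemma filterlim_dyadic_above:
  assumes "0 \<le> t"
  shows "filterlim (\<lambda>n. dyadic_above n t) (at_right t) sequentially"
proof -
  have "(\<lambda>n. t + 1 / 2 ^ n) \<longlonglongrightarrow> t + 0"
    by (intro tendsto_intros LIMSEQ_divide_realpow_zero) simp
  then have upper: "(\<lambda>n. t + 1 / 2 ^ n) \<longlonglongrightarrow> t" by simp
  have "(\<lambda>n. dyadic_above n t) \<longlonglongrightarrow> t"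
    by (rule tendsto_sandwich[OF _ _ tendsto_const upper])
       (use dyadic_above_bounds[OF assms] in \<open>simp_all add: less_eq_real_def\<close>)
  moreover have "dyadic_above n t \<in> {t<..} \<and> dyadic_above n t \<noteq> t" for n
    using dyadic_above_bounds(1)[OF assms, of n] by simp
  ultimately show ?thesis
    unfolding filterlim_at by simp
qed

text \<open>Only countably many times enter, which makes this version jointly measurable in time and
  sample point. On a cadlag path it agrees with the process.\<close>

definition right_version ::
  "(real \<Rightarrow> 'w \<Rightarrow> 'b::{banach,second_countable_topology}) \<Rightarrow> real \<Rightarrow> 'w \<Rightarrow> 'b" where
  "right_version X t \<omega> = lim (\<lambda>n. X (dyadic_above n t) \<omega>)"

lemma right_version_eq:
  assumes "cadlag (\<lambda>t. X t \<omega>)" "0 \<le> t"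
  shows "right_version X t \<omega> = X t \<omega>"
  unfolding right_version_def
proof (rule limI)
  have "((\<lambda>t. X t \<omega>) \<longlongrightarrow> X t \<omega>) (at_right t)"
    using assms by (simp add: cadlag_def)
  then show "(\<lambda>n. X (dyadic_above n t) \<omega>) \<longlonglongrightarrow> X t \<omega>"
    by (rule filterlim_compose[OF _ filterlim_dyadic_above[OF assms(2)]])
qed

text \<open>For each \<open>n\<close> the approximating time takes countably many values, and on
  each of them the map is a single random variable. The sigma-algebra \<open>N\<close> is left free
  so that the result serves both for \<open>M\<close> and for the sigma-algebra generated by the
  process.\<close>

lemma measurable_right_version:
  fixes X :: "real \<Rightarrow> 'w \<Rightarrow> 'b::{banach,second_countable_topology}"
  assumes "\<And>t. 0 \<le> t \<Longrightarrow> X t \<in> borel_measurable N"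
  shows "(\<lambda>(t, \<omega>). right_version X t \<omega>) \<in> borel_measurable (borel \<Otimes>\<^sub>M N)"
proof -
  have "(\<lambda>p::real \<times> 'w. X (real (nat \<lfloor>fst p * 2 ^ n\<rfloor> + 1) / 2 ^ n) (snd p)) \<in> borel_measurable (borel \<Otimes>\<^sub>M N)" for n
  proof (rule measurable_compose_countable[where g="\<lambda>p::real \<times> _. nat \<lfloor>fst p * 2 ^ n\<rfloor>"
        and f="\<lambda>k p. X (real (k + 1) / 2 ^ n) (snd p)"])
    fix k :: nat
    have [measurable]: "X (real (k + 1) / 2 ^ n) \<in> borel_measurable N"
      using assms by simp
    show "(\<lambda>p. X (real (k + 1) / 2 ^ n) (snd p)) \<in> borel_measurable (borel \<Otimes>\<^sub>M N)"
      by measurable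
  qed measurable
  then show ?thesis
    unfolding right_version_def dyadic_above_def split_beta' by (rule borel_measurable_lim_metric)
qed

section \<open>Sigma-algebras of paths and independence of processes\<close>

text \<open>The family \<open>path_events\<close> packaged as a measurable space on the sample
  space. The identity map into it plays the role of the whole path as a random variable.\<close>

definition path_algebra :: "'w measure \<Rightarrow> (real \<Rightarrow> 'w \<Rightarrow> 'b::topological_space) \<Rightarrow> 'w measure" where
  "path_algebra M X = vimage_algebra (space M) (\<lambda>\<omega>. \<lambda>t\<in>{0..}. X t \<omega>) (Pi\<^sub>M {0..} (\<lambda>_. borel))"

lemma space_path_algebra [simp]: "space (path_algebra M X) = space M"
  by (simp add: path_algebra_def)

lemma sets_path_algebra: "sets (path_algebra M X) = path_events M X"
  unfolding path_algebra_def path_events_def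
  by (intro sets_vimage_algebra2) (auto simp: space_PiM)

lemma measurable_path_algebra:
  assumes t: "0 \<le> t"
  shows "X t \<in> borel_measurable (path_algebra M X)"
proof -
  have "(\<lambda>\<omega>. \<lambda>t\<in>{0..}. X t \<omega>) \<in> measurable (path_algebra M X) (Pi\<^sub>M {0..} (\<lambda>_. borel))"
    unfolding path_algebra_def by (rule measurable_vimage_algebra1) (auto simp: space_PiM)
  from measurable_component_singleton[THEN measurable_compose[OF this], of t]
  show ?thesis using t by simp
qed

lemma measurable_id_path_algebra:
  assumes "\<And>t. 0 \<le> t \<Longrightarrow> X t \<in> borel_measurable M"
  shows "(\<lambda>\<omega>. \<omega>) \<in> measurable M (path_algebra M X)"
  unfolding path_algebra_def
proof (rule measurable_vimage_algebra2)
  show "(\<lambda>\<omega>. \<lambda>t\<in>{0..}. X t \<omega>) \<in> measurable M (Pi\<^sub>M {0..} (\<lambda>_. borel))"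
    by (rule measurable_restrict) (rule assms, simp)
qed simp

text \<open>Independence of the processes is independence of the identity map read in the two path
  sigma-algebras, so a functional of both paths may be evaluated at two separate sample points.
  Later the inner point carries \<open>B\<close> and the outer one \<open>S\<close>.\<close>

lemma (in prob_space) indep_processes_nn_integral:
  assumes ind: "indep_processes M X Y"
    and X: "\<And>t. 0 \<le> t \<Longrightarrow> X t \<in> borel_measurable M"
    and Y: "\<And>t. 0 \<le> t \<Longrightarrow> Y t \<in> borel_measurable M"
    and F: "F \<in> borel_measurable (path_algebra M X \<Otimes>\<^sub>M path_algebra M Y)"
  shows "(\<integral>\<^sup>+\<omega>. F (\<omega>, \<omega>) \<partial>M) = (\<integral>\<^sup>+\<omega>. \<integral>\<^sup>+\<omega>'. F (\<omega>', \<omega>) \<partial>M \<partial>M)"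
proof -
  \<comment> \<open>\<open>indep_var_eq\<close> speaks of the sigma-algebra generated by preimages;
    for the identity map these preimages are already the sets of \<open>N\<close>.\<close>
  have *: "sigma_sets (space M) {(\<lambda>\<omega>. \<omega>) -` A \<inter> space M | A. A \<in> sets N} = sets N"
    if "space N = space M" for N :: "'a measure"
  proof -
    have "{(\<lambda>\<omega>. \<omega>) -` A \<inter> space M | A. A \<in> sets N} = sets N"
      using sets.sets_into_space[of _ N] that by (auto simp: Int_absorb2)
    then show ?thesis by (metis sets.sigma_sets_eq that)
  qed
  have "indep_var (path_algebra M X) (\<lambda>\<omega>. \<omega>) (path_algebra M Y) (\<lambda>\<omega>. \<omega>)"
    unfolding indep_var_eq *[OF space_path_algebra]
  proof (intro conjI)
    show "(\<lambda>\<omega>. \<omega>) \<in> measurable M (path_algebra M X)"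
      by (rule measurable_id_path_algebra) (rule X)
    show "(\<lambda>\<omega>. \<omega>) \<in> measurable M (path_algebra M Y)"
      by (rule measurable_id_path_algebra) (rule Y)
    show "indep_set (sets (path_algebra M X)) (sets (path_algebra M Y))"
      using ind by (simp only: indep_processes_def sets_path_algebra)
  qed
  then show ?thesis by (rule indep_var_nn_integral[OF _ F])
qed

text \<open>Independence of the increments gives the product, and stationarity replaces each
  increment by the process at the elapsed time.\<close>

lemma levy_process_nn_integral_increments:
  fixes X :: "real \<Rightarrow> 'w \<Rightarrow> 'b::euclidean_space" and G :: "nat \<Rightarrow> 'b \<Rightarrow> ennreal"
  assumes X: "levy_process M X"
    and t: "0 \<le> t 0" "\<And>i. i < n \<Longrightarrow> t i \<le> t (Suc i)"
    and G: "\<And>i. i < n \<Longrightarrow> G i \<in> borel_measurable borel"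
  shows "(\<integral>\<^sup>+\<omega>. (\<Prod>i<n. G i (X (t (Suc i)) \<omega> - X (t i) \<omega>)) \<partial>M)
    = (\<Prod>i<n. \<integral>\<^sup>+\<omega>. G i (X (t (Suc i) - t i) \<omega>) \<partial>M)"
proof -
  interpret prob_space M using X by (simp add: levy_process_def)
  have m: "0 \<le> s \<Longrightarrow> X s \<in> borel_measurable M" for s
    using X by (simp add: levy_process_def)
  have stationary: "0 \<le> s \<Longrightarrow> 0 \<le> r \<Longrightarrow>
      distr M borel (\<lambda>\<omega>. X (s + r) \<omega> - X s \<omega>) = distr M borel (X r)" for s r
    using X by (simp add: levy_process_def)
  have tn: "0 \<le> t i" if "i \<le> n" for i
    using that by (induction i) (use t in \<open>auto intro: order_trans\<close>)
  have "indep_vars (\<lambda>_. borel) (\<lambda>i \<omega>. X (t (Suc i)) \<omega> - X (t i) \<omega>) {..<n}"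
    using X t unfolding levy_process_def by blast
  then have ind: "indep_vars (\<lambda>_. borel) (\<lambda>i \<omega>. G i (X (t (Suc i)) \<omega> - X (t i) \<omega>)) {..<n}"
    by (rule indep_vars_compose2) (use G in auto)
  have "(\<integral>\<^sup>+\<omega>. (\<Prod>i<n. G i (X (t (Suc i)) \<omega> - X (t i) \<omega>)) \<partial>M)
    = (\<Prod>i<n. \<integral>\<^sup>+\<omega>. G i (X (t (Suc i)) \<omega> - X (t i) \<omega>) \<partial>M)"
    by (rule indep_vars_nn_integral[OF _ ind]) auto
  also have "\<dots> = (\<Prod>i<n. \<integral>\<^sup>+\<omega>. G i (X (t (Suc i) - t i) \<omega>) \<partial>M)"
  proof (intro prod.cong refl)
    fix i assume "i \<in> {..<n}"
    then have i: "i < n" by simp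
    have [measurable]: "G i \<in> borel_measurable borel" "X (t i) \<in> borel_measurable M"
        "X (t (Suc i)) \<in> borel_measurable M" "X (t (Suc i) - t i) \<in> borel_measurable M"
      using i G tn[of i] tn[of "Suc i"] t(2)[of i] by (auto intro!: m)
    have "distr M borel (\<lambda>\<omega>. X (t i + (t (Suc i) - t i)) \<omega> - X (t i) \<omega>)
        = distr M borel (X (t (Suc i) - t i))"
      using tn[of i] t(2)[OF i] i by (intro stationary) auto
    then have eq: "distr M borel (\<lambda>\<omega>. X (t (Suc i)) \<omega> - X (t i) \<omega>)
        = distr M borel (X (t (Suc i) - t i))" by simp
    have "(\<integral>\<^sup>+\<omega>. G i (X (t (Suc i)) \<omega> - X (t i) \<omega>) \<partial>M)
        = (\<integral>\<^sup>+x. G i x \<partial>distr M borel (\<lambda>\<omega>. X (t (Suc i)) \<omega> - X (t i) \<omega>))"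
      by (rule nn_integral_distr[symmetric]) measurable
    also have "\<dots> = (\<integral>\<^sup>+\<omega>. G i (X (t (Suc i) - t i) \<omega>) \<partial>M)"
      unfolding eq by (rule nn_integral_distr) measurable
    finally show "(\<integral>\<^sup>+\<omega>. G i (X (t (Suc i)) \<omega> - X (t i) \<omega>) \<partial>M)
        = (\<integral>\<^sup>+\<omega>. G i (X (t (Suc i) - t i) \<omega>) \<partial>M)" .
  qed
  finally show ?thesis .
qed

section \<open>Subordination\<close>

locale subordination = prob_space M for M :: "'w measure" +
  fixes S :: "real \<Rightarrow> 'w \<Rightarrow> real" and B :: "real \<Rightarrow> 'w \<Rightarrow> 'a::euclidean_space"
  assumes subordinator_S: "subordinator M S" and levy_B: "levy_process M B"
    and indep_BS: "indep_processes M B S"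
begin

text \<open>\<open>S\<close> and \<open>B\<close> are only almost surely cadlag, so substituting \<open>S t\<close> for the time of \<open>B\<close> need not
  be measurable; it is for the versions \<open>SV\<close> and \<open>BV\<close>.\<close>

definition SV :: "real \<Rightarrow> 'w \<Rightarrow> real" where "SV = right_version S"

definition BV :: "real \<Rightarrow> 'w \<Rightarrow> 'a" where "BV = right_version B"

definition X :: "real \<Rightarrow> 'w \<Rightarrow> 'a" where "X t \<omega> = BV (SV t \<omega>) \<omega>"

lemma levy_S: "levy_process M S"
  using subordinator_S by (simp add: subordinator_def)

lemma measurable_S: "0 \<le> t \<Longrightarrow> S t \<in> borel_measurable M"
  using levy_S by (simp add: levy_process_def)

lemma measurable_B: "0 \<le> t \<Longrightarrow> B t \<in> borel_measurable M"
  using levy_B by (simp add: levy_process_def)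

lemma AE_SV: "AE \<omega> in M. \<forall>t\<ge>0. SV t \<omega> = S t \<omega> \<and> 0 \<le> S t \<omega>"
proof -
  have "AE \<omega> in M. cadlag (\<lambda>t. S t \<omega>)" "AE \<omega> in M. \<forall>t\<ge>0. 0 \<le> S t \<omega>"
    using subordinator_S by (auto simp: subordinator_def levy_process_def)
  then show ?thesis
    by eventually_elim (simp add: SV_def right_version_eq)
qed

lemma AE_BV: "AE \<omega> in M. \<forall>t\<ge>0. BV t \<omega> = B t \<omega>"
proof -
  have "AE \<omega> in M. cadlag (\<lambda>t. B t \<omega>)"
    using levy_B by (simp add: levy_process_def)
  then show ?thesis
    by eventually_elim (simp add: BV_def right_version_eq)
qed

lemma measurable_SV_path: "(\<lambda>(t, \<omega>). SV t \<omega>) \<in> borel_measurable (borel \<Otimes>\<^sub>M path_algebra M S)"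
  unfolding SV_def by (rule measurable_right_version) (rule measurable_path_algebra)

lemma measurable_BV_path: "(\<lambda>(t, \<omega>). BV t \<omega>) \<in> borel_measurable (borel \<Otimes>\<^sub>M path_algebra M B)"
  unfolding BV_def by (rule measurable_right_version) (rule measurable_path_algebra)

lemma measurable_SV: "(\<lambda>(t, \<omega>). SV t \<omega>) \<in> borel_measurable (borel \<Otimes>\<^sub>M M)"
  unfolding SV_def by (rule measurable_right_version) (rule measurable_S)

lemma measurable_BV: "(\<lambda>(t, \<omega>). BV t \<omega>) \<in> borel_measurable (borel \<Otimes>\<^sub>M M)"
  unfolding BV_def by (rule measurable_right_version) (rule measurable_B)

lemma measurable_SV_compose [measurable (raw)]:
  assumes [measurable]: "f \<in> borel_measurable N" "g \<in> measurable N M"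
  shows "(\<lambda>x. SV (f x) (g x)) \<in> borel_measurable N"
proof -
  have "(\<lambda>x. (f x, g x)) \<in> measurable N (borel \<Otimes>\<^sub>M M)" by measurable
  from measurable_compose[OF this measurable_SV] show ?thesis by simp
qed

lemma measurable_BV_compose [measurable (raw)]:
  assumes [measurable]: "f \<in> borel_measurable N" "g \<in> measurable N M"
  shows "(\<lambda>x. BV (f x) (g x)) \<in> borel_measurable N"
proof -
  have "(\<lambda>x. (f x, g x)) \<in> measurable N (borel \<Otimes>\<^sub>M M)" by measurable
  from measurable_compose[OF this measurable_BV] show ?thesis by simp
qed

lemma measurable_X_compose [measurable (raw)]:
  assumes [measurable]: "f \<in> borel_measurable N" "g \<in> measurable N M"
  shows "(\<lambda>x. X (f x) (g x)) \<in> borel_measurable N"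
  unfolding X_def by measurable

lemma measurable_BV_SV_path:
  "(\<lambda>p. BV (SV t (snd p)) (fst p)) \<in> borel_measurable (path_algebra M B \<Otimes>\<^sub>M path_algebra M S)"
proof -
  have "(\<lambda>\<omega>. (t, \<omega>)) \<in> measurable (path_algebra M S) (borel \<Otimes>\<^sub>M path_algebra M S)" by measurable
  from measurable_compose[OF this measurable_SV_path]
  have [measurable]: "SV t \<in> borel_measurable (path_algebra M S)" by simp
  have "(\<lambda>p. (SV t (snd p), fst p)) \<in>
      measurable (path_algebra M B \<Otimes>\<^sub>M path_algebra M S) (borel \<Otimes>\<^sub>M path_algebra M B)"
    by measurable
  from measurable_compose[OF this measurable_BV_path] show ?thesis by simp
qed

section \<open>Increments of the subordinate process\<close>

text \<open>By stationarity \<open>S t - S s\<close> has the law of \<open>S (t - s)\<close>, which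
  is almost surely nonnegative. The exceptional null set may depend on \<open>s\<close> and
  \<open>t\<close>.\<close>

lemma AE_S_mono:
  assumes "0 \<le> s" "s \<le> t"
  shows "AE \<omega> in M. S s \<omega> \<le> S t \<omega>"
proof -
  have [measurable]: "S s \<in> borel_measurable M" "S t \<in> borel_measurable M"
      "S (t - s) \<in> borel_measurable M"
    using assms by (auto intro: measurable_S)
  have "distr M borel (\<lambda>\<omega>. S (s + (t - s)) \<omega> - S s \<omega>) = distr M borel (S (t - s))"
    using levy_S assms unfolding levy_process_def by (metis diff_ge_0_iff_ge)
  then have eq: "distr M borel (\<lambda>\<omega>. S t \<omega> - S s \<omega>) = distr M borel (S (t - s))" by simp
  have "AE \<omega> in M. 0 \<le> S (t - s) \<omega>"
    using AE_SV by eventually_elim (use assms in auto)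
  then have "AE x in distr M borel (S (t - s)). 0 \<le> x"
    by (subst AE_distr_iff) auto
  then have "AE \<omega> in M. 0 \<le> S t \<omega> - S s \<omega>"
    unfolding eq[symmetric] by (subst (asm) AE_distr_iff) auto
  then show ?thesis by eventually_elim simp
qed

lemma nn_integral_X:
  assumes t: "0 \<le> t" and G[measurable]: "G \<in> borel_measurable borel"
  shows "(\<integral>\<^sup>+\<omega>. G (X t \<omega>) \<partial>M) = (\<integral>\<^sup>+\<omega>. \<integral>\<^sup>+\<omega>'. G (BV (SV t \<omega>) \<omega>') \<partial>M \<partial>M)"
proof -
  have "(\<lambda>p. G (BV (SV t (snd p)) (fst p))) \<in> borel_measurable (path_algebra M B \<Otimes>\<^sub>M path_algebra M S)"
    by (rule measurable_compose[OF measurable_BV_SV_path G])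
  from indep_processes_nn_integral[OF indep_BS measurable_B measurable_S this]
  show ?thesis by (simp add: X_def)
qed

lemma nn_integral_X_increments:
  fixes G :: "nat \<Rightarrow> 'a \<Rightarrow> ennreal"
  assumes t: "0 \<le> t 0" "\<And>i. i < n \<Longrightarrow> t i \<le> t (Suc i)"
    and G: "\<And>i. i < n \<Longrightarrow> G i \<in> borel_measurable borel"
  shows "(\<integral>\<^sup>+\<omega>. (\<Prod>i<n. G i (X (t (Suc i)) \<omega> - X (t i) \<omega>)) \<partial>M)
    = (\<Prod>i<n. \<integral>\<^sup>+\<omega>. G i (X (t (Suc i) - t i) \<omega>) \<partial>M)"
proof -
  have tn: "0 \<le> t i" if "i \<le> n" for i
    using that by (induction i) (use t in \<open>auto intro: order_trans\<close>)
  define g where "g i a = (\<integral>\<^sup>+\<omega>. G i (BV a \<omega>) \<partial>M)" for i a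
  have g: "g i \<in> borel_measurable borel" if "i < n" for i
  proof -
    have [measurable]: "G i \<in> borel_measurable borel" using G that .
    show ?thesis unfolding g_def by measurable
  qed
  define F where "F p = (\<Prod>i<n. G i (BV (SV (t (Suc i)) (snd p)) (fst p) - BV (SV (t i) (snd p)) (fst p)))"
    for p
  have F: "F \<in> borel_measurable (path_algebra M B \<Otimes>\<^sub>M path_algebra M S)"
    unfolding F_def
  proof (rule borel_measurable_prod_ennreal)
    fix i assume "i \<in> {..<n}"
    then have "G i \<in> borel_measurable borel" using G by simp
    then show "(\<lambda>p. G i (BV (SV (t (Suc i)) (snd p)) (fst p) - BV (SV (t i) (snd p)) (fst p)))
        \<in> borel_measurable (path_algebra M B \<Otimes>\<^sub>M path_algebra M S)"
      by (intro measurable_compose[OF _ \<open>G i \<in> _\<close>] borel_measurable_diff measurable_BV_SV_path)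
  qed
  \<comment> \<open>Finitely many times occur, so the null sets from \<open>AE_S_mono\<close> can be
    united.\<close>
  have mono: "AE \<omega> in M. \<forall>i\<in>{..<n}. S (t i) \<omega> \<le> S (t (Suc i)) \<omega>"
    by (rule AE_finite_allI) (use tn t in \<open>auto intro!: AE_S_mono\<close>)
  have "(\<integral>\<^sup>+\<omega>. (\<Prod>i<n. G i (X (t (Suc i)) \<omega> - X (t i) \<omega>)) \<partial>M)
      = (\<integral>\<^sup>+\<omega>. \<integral>\<^sup>+\<omega>'. F (\<omega>', \<omega>) \<partial>M \<partial>M)"
    using indep_processes_nn_integral[OF indep_BS measurable_B measurable_S F]
    by (simp add: X_def F_def)
  \<comment> \<open>For fixed \<open>\<omega>\<close> the times \<open>S (t i) \<omega>\<close> are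
    deterministic, nonnegative and ordered, as the increment formula for \<open>B\<close> in
    \<open>\<omega>'\<close> requires.\<close>
  also have "\<dots> = (\<integral>\<^sup>+\<omega>. (\<Prod>i<n. g i (S (t (Suc i)) \<omega> - S (t i) \<omega>)) \<partial>M)"
  proof (rule nn_integral_cong_AE, use AE_SV mono in eventually_elim)
    case (elim \<omega>)
    define s where "s i = S (t i) \<omega>" for i
    have sn: "0 \<le> s i" if "i \<le> n" for i
      using elim(1) tn that by (simp add: s_def)
    have sm: "s i \<le> s (Suc i)" if "i < n" for i
      using elim(2) that by (simp add: s_def)
    have "(\<integral>\<^sup>+\<omega>'. F (\<omega>', \<omega>) \<partial>M)
        = (\<integral>\<^sup>+\<omega>'. (\<Prod>i<n. G i (B (s (Suc i)) \<omega>' - B (s i) \<omega>')) \<partial>M)"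
    proof (rule nn_integral_cong_AE, use AE_BV in eventually_elim)
      case inner: (elim \<omega>')
      show ?case
        unfolding F_def
      proof (rule prod.cong)
        fix i assume "i \<in> {..<n}"
        then show "G i (BV (SV (t (Suc i)) (snd (\<omega>', \<omega>))) (fst (\<omega>', \<omega>)) - BV (SV (t i) (snd (\<omega>', \<omega>))) (fst (\<omega>', \<omega>)))
            = G i (B (s (Suc i)) \<omega>' - B (s i) \<omega>')"
          using inner elim(1) tn[of i] tn[of "Suc i"] sn[of i] sn[of "Suc i"] by (simp add: s_def)
      qed simp
    qed
    also have "\<dots> = (\<Prod>i<n. \<integral>\<^sup>+\<omega>'. G i (B (s (Suc i) - s i) \<omega>') \<partial>M)"
      by (rule levy_process_nn_integral_increments[OF levy_B]) (use sn sm G in auto)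
    also have "\<dots> = (\<Prod>i<n. g i (s (Suc i) - s i))"
    proof (rule prod.cong)
      fix i assume "i \<in> {..<n}"
      then have "0 \<le> s (Suc i) - s i" using sm by simp
      then show "(\<integral>\<^sup>+\<omega>'. G i (B (s (Suc i) - s i) \<omega>') \<partial>M) = g i (s (Suc i) - s i)"
        unfolding g_def by (intro nn_integral_cong_AE) (use AE_BV in eventually_elim, simp)
    qed simp
    finally show ?case by (simp add: s_def)
  qed
  also have "\<dots> = (\<Prod>i<n. \<integral>\<^sup>+\<omega>. g i (S (t (Suc i) - t i) \<omega>) \<partial>M)"
    by (rule levy_process_nn_integral_increments[OF levy_S]) (use t g in auto)
  also have "\<dots> = (\<Prod>i<n. \<integral>\<^sup>+\<omega>. G i (X (t (Suc i) - t i) \<omega>) \<partial>M)"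
  proof (rule prod.cong)
    fix i assume "i \<in> {..<n}"
    then have i: "0 \<le> t (Suc i) - t i" "G i \<in> borel_measurable borel" using t G by auto
    have "(\<integral>\<^sup>+\<omega>. g i (S (t (Suc i) - t i) \<omega>) \<partial>M) = (\<integral>\<^sup>+\<omega>. g i (SV (t (Suc i) - t i) \<omega>) \<partial>M)"
      by (rule nn_integral_cong_AE, use AE_SV in eventually_elim) (use i in simp)
    also have "\<dots> = (\<integral>\<^sup>+\<omega>. G i (X (t (Suc i) - t i) \<omega>) \<partial>M)"
      unfolding g_def by (rule nn_integral_X[symmetric]) (use i in auto)
    finally show "(\<integral>\<^sup>+\<omega>. g i (S (t (Suc i) - t i) \<omega>) \<partial>M)
        = (\<integral>\<^sup>+\<omega>. G i (X (t (Suc i) - t i) \<omega>) \<partial>M)" .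
  qed simp
  finally show ?thesis .
qed

lemma nn_integral_X_increment:
  assumes "0 \<le> s" "s \<le> t" "G \<in> borel_measurable borel"
  shows "(\<integral>\<^sup>+\<omega>. G (X t \<omega> - X s \<omega>) \<partial>M) = (\<integral>\<^sup>+\<omega>. G (X (t - s) \<omega>) \<partial>M)"
  using nn_integral_X_increments[of "\<lambda>i. if i = 0 then s else t" 1 "\<lambda>_. G"] assms by simp

lemma indep_vars_X_increments:
  assumes t: "0 \<le> t 0" "\<And>i. i < n \<Longrightarrow> t i \<le> t (Suc i)"
  shows "indep_vars (\<lambda>_. borel) (\<lambda>i \<omega>. X (t (Suc i)) \<omega> - X (t i) \<omega>) {..<n}"
proof (rule indep_varsI_nn_integral)
  have tn: "0 \<le> t i" if "i \<le> n" for i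
    using that by (induction i) (use t in \<open>auto intro: order_trans\<close>)
  fix G :: "nat \<Rightarrow> 'a \<Rightarrow> ennreal"
  assume G: "\<And>i. i < n \<Longrightarrow> G i \<in> borel_measurable borel"
  show "(\<integral>\<^sup>+\<omega>. (\<Prod>i<n. G i (X (t (Suc i)) \<omega> - X (t i) \<omega>)) \<partial>M)
      = (\<Prod>i<n. \<integral>\<^sup>+\<omega>. G i (X (t (Suc i)) \<omega> - X (t i) \<omega>) \<partial>M)"
    by (subst nn_integral_X_increments[where n=n, OF t G])
       (use tn t G in \<open>auto simp: nn_integral_X_increment intro!: prod.cong\<close>)
qed measurable

lemma AE_X_0: "AE \<omega> in M. X 0 \<omega> = 0"
proof -
  have "AE \<omega> in M. S 0 \<omega> = 0" "AE \<omega> in M. B 0 \<omega> = 0"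
    using levy_S levy_B by (auto simp: levy_process_def)
  with AE_SV AE_BV show ?thesis
    by eventually_elim (simp add: X_def)
qed

text \<open>The semigroup property: on the grid \<open>0\<close>, \<open>h\<close>,
  \<open>h + t\<close> the two increments of \<open>X\<close> are independent, the second has the
  law of \<open>X t\<close>, and \<open>X 0\<close> vanishes almost surely.\<close>

lemma nn_integral_X_convolution:
  assumes h: "0 \<le> h" and t: "0 \<le> t" and f[measurable]: "f \<in> borel_measurable borel"
  shows "(\<integral>\<^sup>+\<omega>. \<integral>\<^sup>+\<omega>'. f (X h \<omega> + X t \<omega>') \<partial>M \<partial>M) = (\<integral>\<^sup>+\<omega>. f (X (h + t) \<omega>) \<partial>M)"
proof -
  let ?t = "\<lambda>i::nat. if i = 0 then 0 else if i = 1 then h else h + t"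
  have "indep_vars (\<lambda>_. borel) (\<lambda>i \<omega>. X (?t (Suc i)) \<omega> - X (?t i) \<omega>) {..<2}"
    by (rule indep_vars_X_increments) (use h t in auto)
  from indep_var_restrict[OF this, of "{1}" "{0}"]
  have "indep_var (Pi\<^sub>M {1} (\<lambda>_. borel)) (\<lambda>\<omega>. \<lambda>i\<in>{1}. X (?t (Suc i)) \<omega> - X (?t i) \<omega>)
     (Pi\<^sub>M {0} (\<lambda>_. borel)) (\<lambda>\<omega>. \<lambda>i\<in>{0}. X (?t (Suc i)) \<omega> - X (?t i) \<omega>)" by auto
  then have "indep_var borel ((\<lambda>y. y (1::nat)) \<circ> (\<lambda>\<omega>. \<lambda>i\<in>{1}. X (?t (Suc i)) \<omega> - X (?t i) \<omega>))
     borel ((\<lambda>y. y (0::nat)) \<circ> (\<lambda>\<omega>. \<lambda>i\<in>{0}. X (?t (Suc i)) \<omega> - X (?t i) \<omega>))"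
    by (rule indep_var_compose) measurable
  then have ind: "indep_var borel (\<lambda>\<omega>. X (h + t) \<omega> - X h \<omega>) borel (\<lambda>\<omega>. X h \<omega> - X 0 \<omega>)"
    by (simp add: comp_def)
  have "(\<integral>\<^sup>+\<omega>. f (X (h + t) \<omega>) \<partial>M)
      = (\<integral>\<^sup>+\<omega>. f ((X h \<omega> - X 0 \<omega>) + (X (h + t) \<omega> - X h \<omega>)) \<partial>M)"
    by (rule nn_integral_cong_AE, use AE_X_0 in eventually_elim) simp
  also have "\<dots> = (\<integral>\<^sup>+\<omega>. \<integral>\<^sup>+\<omega>'. f ((X h \<omega> - X 0 \<omega>) + (X (h + t) \<omega>' - X h \<omega>')) \<partial>M \<partial>M)"
    using indep_var_nn_integral[OF ind, of "\<lambda>p. f (snd p + fst p)"] by simp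
  also have "\<dots> = (\<integral>\<^sup>+\<omega>. \<integral>\<^sup>+\<omega>'. f ((X h \<omega> - X 0 \<omega>) + X t \<omega>') \<partial>M \<partial>M)"
    using nn_integral_X_increment[of h "h + t" "\<lambda>y. f (z + y)" for z] h t by simp
  also have "\<dots> = (\<integral>\<^sup>+\<omega>. \<integral>\<^sup>+\<omega>'. f (X h \<omega> + X t \<omega>') \<partial>M \<partial>M)"
    by (rule nn_integral_cong_AE, use AE_X_0 in eventually_elim) simp
  finally show ?thesis ..
qed

section \<open>The potential operator of \<open>X\<close>\<close>

text \<open>The potential operator of the process, called \<open>Uf\<close> in the outline of the
  proof.\<close>

definition Green :: "('a \<Rightarrow> ennreal) \<Rightarrow> 'a \<Rightarrow> ennreal" where
  "Green f z = (\<integral>\<^sup>+t\<in>{0..}. (\<integral>\<^sup>+\<omega>. f (z + X t \<omega>) \<partial>M) \<partial>lborel)"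

lemma measurable_Green [measurable]:
  assumes [measurable]: "f \<in> borel_measurable borel"
  shows "Green f \<in> borel_measurable borel"
  unfolding Green_def by measurable

text \<open>By the semigroup property the left side is the expected integral of \<open>f\<close>
  along the path after time \<open>h\<close> only; the part before \<open>h\<close> is
  nonnegative.\<close>

lemma Green_excessive:
  assumes h: "0 \<le> h" and f[measurable]: "f \<in> borel_measurable borel"
  shows "(\<integral>\<^sup>+\<omega>. Green f (z + X h \<omega>) \<partial>M) \<le> Green f z"
proof -
  interpret P: pair_sigma_finite lborel M ..
  have "(\<integral>\<^sup>+\<omega>. Green f (z + X h \<omega>) \<partial>M)
      = (\<integral>\<^sup>+t. \<integral>\<^sup>+\<omega>. (\<integral>\<^sup>+\<omega>'. f (z + X h \<omega> + X t \<omega>') \<partial>M) * indicator {0..} t \<partial>M \<partial>lborel)"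
    unfolding Green_def by (rule P.Fubini') measurable
  also have "\<dots> = (\<integral>\<^sup>+t. (\<integral>\<^sup>+\<omega>. f (z + X (h + t) \<omega>) \<partial>M) * indicator {0..} t \<partial>lborel)"
  proof (rule nn_integral_cong)
    fix t :: real
    show "(\<integral>\<^sup>+\<omega>. (\<integral>\<^sup>+\<omega>'. f (z + X h \<omega> + X t \<omega>') \<partial>M) * indicator {0..} t \<partial>M)
        = (\<integral>\<^sup>+\<omega>. f (z + X (h + t) \<omega>) \<partial>M) * indicator {0..} t"
      using nn_integral_X_convolution[OF h, of t "\<lambda>y. f (z + y)"]
      by (cases "0 \<le> t") (auto simp: add.assoc)
  qed
  \<comment> \<open>Admitting \<open>t\<close> down to \<open>-h\<close> puts back the times in
    \<open>[0, h)\<close>, and the shift by \<open>h\<close> then gives the full potential.\<close>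
  also have "\<dots> \<le> (\<integral>\<^sup>+t. (\<integral>\<^sup>+\<omega>. f (z + X (h + t) \<omega>) \<partial>M) * indicator {0..} (h + t) \<partial>lborel)"
    using h by (intro nn_integral_mono) (auto simp: indicator_def)
  also have "\<dots> = Green f z"
    unfolding Green_def
    by (subst nn_integral_real_affine[where c=1 and t=h]) (auto simp: add.commute)
  finally show ?thesis .
qed

text \<open>The process sampled at multiples of \<open>h\<close> is a random walk, and
  \<open>Green f\<close> is excessive for it. The bound depends neither on the mesh \<open>h\<close>
  nor on the horizon \<open>n\<close>, so it survives refinement of the grid.\<close>

lemma X_hitting_bound:
  assumes h: "0 \<le> h" and f[measurable]: "f \<in> borel_measurable borel" and A[measurable]: "A \<in> sets borel"
    and lower: "\<And>z. z \<in> A \<Longrightarrow> \<iota> \<le> Green f z"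
  shows "\<iota> * emeasure M {\<omega>\<in>space M. \<exists>k\<le>n. x + X (real k * h) \<omega> \<in> A} \<le> Green f x"
proof -
  let ?Y = "\<lambda>i \<omega>. X (real (Suc i) * h) \<omega> - X (real i * h) \<omega>"
  have "\<iota> * emeasure M {\<omega>\<in>space M. \<exists>k\<le>n. x + (\<Sum>i<k. ?Y i \<omega>) \<in> A} \<le> Green f x"
  proof (rule excessive_hitting_bound)
    show "indep_vars (\<lambda>_. borel) ?Y {..<n}"
      by (rule indep_vars_X_increments) (use h in \<open>auto intro: mult_right_mono\<close>)
    show "(\<integral>\<^sup>+\<omega>. Green f (z + ?Y i \<omega>) \<partial>M) \<le> Green f z" if "i < n" for i z
    proof -
      have "(\<integral>\<^sup>+\<omega>. Green f (z + ?Y i \<omega>) \<partial>M)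
          = (\<integral>\<^sup>+\<omega>. Green f (z + X (real (Suc i) * h - real i * h) \<omega>) \<partial>M)"
        by (rule nn_integral_X_increment[where G="\<lambda>y. Green f (z + y)"])
           (use h in \<open>auto intro: mult_right_mono\<close>)
      also have "\<dots> \<le> Green f z"
        using Green_excessive[OF h f, of z] by (simp add: algebra_simps)
      finally show ?thesis .
    qed
  qed (use lower in auto)
  also have "emeasure M {\<omega>\<in>space M. \<exists>k\<le>n. x + (\<Sum>i<k. ?Y i \<omega>) \<in> A}
      = emeasure M {\<omega>\<in>space M. \<exists>k\<le>n. x + X (real k * h) \<omega> \<in> A}"
  proof (rule emeasure_eq_AE)
    \<comment> \<open>The partial sums telescope to \<open>X (real k * h) - X 0\<close>, and
      \<open>X 0\<close> is zero only almost surely.\<close>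
    have "(\<Sum>i<k. ?Y i \<omega>) = X (real k * h) \<omega> - X 0 \<omega>" for k \<omega>
      using sum_lessThan_telescope[of "\<lambda>i. X (real i * h) \<omega>" k] by simp
    note sum = this
    show "AE \<omega> in M. \<omega> \<in> {\<omega>\<in>space M. \<exists>k\<le>n. x + (\<Sum>i<k. ?Y i \<omega>) \<in> A}
        \<longleftrightarrow> \<omega> \<in> {\<omega>\<in>space M. \<exists>k\<le>n. x + X (real k * h) \<omega> \<in> A}"
      using AE_X_0 by eventually_elim (simp add: sum del: of_nat_Suc)
  qed measurable
  finally show ?thesis .
qed

text \<open>The occupation formula. The auxiliary \<open>?N\<close> is the image under
  \<open>SV\<close> of Lebesgue measure on \<open>[0, \<infinity>)\<close> times \<open>M\<close>;
  it agrees with the potential measure on Borel sets, hence under integration.\<close>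

lemma nn_integral_SV_potential:
  assumes pot: "\<And>A. A \<in> sets borel \<Longrightarrow> potential M S A = (\<integral>\<^sup>+s\<in>A. u s \<partial>lborel)"
    and u[measurable]: "u \<in> borel_measurable borel" and g[measurable]: "g \<in> borel_measurable borel"
  shows "(\<integral>\<^sup>+t\<in>{0..}. (\<integral>\<^sup>+\<omega>. g (SV t \<omega>) \<partial>M) \<partial>lborel) = (\<integral>\<^sup>+s. u s * g s \<partial>lborel)"
proof -
  interpret P: pair_sigma_finite lborel M ..
  let ?N = "distr (density (lborel \<Otimes>\<^sub>M M) (\<lambda>p. indicator {0..} (fst p))) borel (\<lambda>(t, \<omega>). SV t \<omega>)"
  have SVm: "(\<lambda>(t, \<omega>). SV t \<omega>) \<in> borel_measurable (lborel \<Otimes>\<^sub>M M)"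
    by measurable
  have N: "(\<integral>\<^sup>+s. g s \<partial>?N) = (\<integral>\<^sup>+t\<in>{0..}. (\<integral>\<^sup>+\<omega>. g (SV t \<omega>) \<partial>M) \<partial>lborel)"
    if [measurable]: "g \<in> borel_measurable borel" for g :: "real \<Rightarrow> ennreal"
  proof -
    have "(\<integral>\<^sup>+s. g s \<partial>?N) = (\<integral>\<^sup>+p. indicator {0..} (fst p) * g (SV (fst p) (snd p)) \<partial>(lborel \<Otimes>\<^sub>M M))"
      by (subst nn_integral_distr) (auto simp: nn_integral_density split_beta')
    also have "\<dots> = (\<integral>\<^sup>+t. \<integral>\<^sup>+\<omega>. indicator {0..} t * g (SV t \<omega>) \<partial>M \<partial>lborel)"
      using nn_integral_fst[of "\<lambda>p. indicator {0..} (fst p) * g (SV (fst p) (snd p))" lborel] by simp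
    finally show ?thesis
      by (simp add: nn_integral_cmult mult.commute)
  qed
  have "?N = density lborel u"
  proof (rule measure_eqI)
    fix A assume "A \<in> sets ?N"
    then have A[measurable]: "A \<in> sets borel" by simp
    have "emeasure ?N A = (\<integral>\<^sup>+s. indicator A s \<partial>?N)" by simp
    also have "\<dots> = (\<integral>\<^sup>+t. \<integral>\<^sup>+\<omega>. indicator {0..} t * indicator A (SV t \<omega>) \<partial>M \<partial>lborel)"
      by (subst N) (auto simp: nn_integral_cmult mult.commute)
    also have "\<dots> = (\<integral>\<^sup>+\<omega>. \<integral>\<^sup>+t. indicator {0..} t * indicator A (SV t \<omega>) \<partial>lborel \<partial>M)"
      by (rule P.Fubini'[symmetric]) measurable
    also have "\<dots> = potential M S A"
      unfolding potential_def
    proof (rule nn_integral_cong_AE, use AE_SV in eventually_elim)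
      case (elim \<omega>)
      then show ?case
        by (intro nn_integral_cong) (auto simp: indicator_def)
    qed
    also have "\<dots> = emeasure (density lborel u) A"
      by (simp add: pot emeasure_density)
    finally show "emeasure ?N A = emeasure (density lborel u) A" .
  qed simp
  then show ?thesis
    using N[OF g] by (simp add: nn_integral_density)
qed

text \<open>Integrating out \<open>B\<close> first leaves a function of \<open>SV t\<close> alone,
  to which the occupation formula applies. All later estimates use only this representation.\<close>

lemma Green_eq:
  assumes pot: "\<And>A. A \<in> sets borel \<Longrightarrow> potential M S A = (\<integral>\<^sup>+s\<in>A. u s \<partial>lborel)"
    and u[measurable]: "u \<in> borel_measurable borel" and f[measurable]: "f \<in> borel_measurable borel"
  shows "Green f z = (\<integral>\<^sup>+s. u s * (\<integral>\<^sup>+\<omega>. f (z + BV s \<omega>) \<partial>M) \<partial>lborel)"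
proof -
  have "Green f z = (\<integral>\<^sup>+t\<in>{0..}. (\<integral>\<^sup>+\<omega>. (\<integral>\<^sup>+\<omega>'. f (z + BV (SV t \<omega>) \<omega>') \<partial>M) \<partial>M) \<partial>lborel)"
    unfolding Green_def
  proof (rule nn_integral_cong)
    fix t :: real
    show "(\<integral>\<^sup>+\<omega>. f (z + X t \<omega>) \<partial>M) * indicator {0..} t
        = (\<integral>\<^sup>+\<omega>. (\<integral>\<^sup>+\<omega>'. f (z + BV (SV t \<omega>) \<omega>') \<partial>M) \<partial>M) * indicator {0..} t"
      using nn_integral_X[of t "\<lambda>y. f (z + y)"] by (cases "0 \<le> t") auto
  qed
  also have "\<dots> = (\<integral>\<^sup>+s. u s * (\<integral>\<^sup>+\<omega>. f (z + BV s \<omega>) \<partial>M) \<partial>lborel)"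
  proof (rule nn_integral_SV_potential[OF _ u])
    show "(\<lambda>s. \<integral>\<^sup>+\<omega>. f (z + BV s \<omega>) \<partial>M) \<in> borel_measurable borel" by measurable
  qed (rule pot)
  finally show ?thesis .
qed

end

section \<open>Laplace transforms and decreasing densities\<close>

lemma tendsto_mult_exp_minus:
  fixes a c :: real
  assumes "0 < a"
  shows "((\<lambda>t. c * exp (- a * t)) \<longlongrightarrow> 0) at_top"
proof -
  have "filterlim (\<lambda>t. - a * t) at_bot at_top"
    by (rule filterlim_tendsto_neg_mult_at_bot[OF tendsto_const _ filterlim_ident]) (use assms in simp)
  then have "((\<lambda>t. exp (- a * t)) \<longlongrightarrow> 0) at_top"
    by (rule filterlim_compose[OF exp_at_bot])
  then show ?thesis by (rule tendsto_mult_right_zero)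
qed

lemma exp_remainder_bound:
  fixes x :: real
  shows "\<bar>exp x - 1 - x\<bar> \<le> x\<^sup>2 * exp \<bar>x\<bar>"
proof -
  obtain t where t: "\<bar>t\<bar> \<le> \<bar>x\<bar>" "exp x = (\<Sum>m<2. x ^ m / fact m) + exp t / fact 2 * x ^ 2"
    using Maclaurin_exp_le[of x 2] by blast
  then have "exp x - 1 - x = x\<^sup>2 * (exp t / 2)"
    by (simp add: numeral_2_eq_2)
  then have "\<bar>exp x - 1 - x\<bar> = \<bar>x\<^sup>2 * (exp t / 2)\<bar>"
    by (simp only:)
  also have "\<dots> = x\<^sup>2 * (exp t / 2)"
    by (simp add: abs_mult)
  also have "\<dots> \<le> x\<^sup>2 * exp \<bar>x\<bar>"
  proof (rule mult_left_mono)
    have "exp t \<le> exp \<bar>x\<bar>" using t(1) by simp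
    then show "exp t / 2 \<le> exp \<bar>x\<bar>" using exp_gt_zero[of t] by linarith
  qed simp
  finally show ?thesis .
qed

text \<open>Differentiation under the integral sign. The second-order Taylor remainder in the
  increment \<open>h\<close> is at most \<open>h\<^sup>2\<close> times an integrable function that
  does not depend on \<open>h\<close>, so the difference quotient converges at rate
  \<open>\<bar>h\<bar>\<close>.\<close>

lemma laplace_transform_DERIV:
  fixes N :: "real measure"
  assumes sets[measurable_cong]: "sets N = sets borel" and pos: "AE s in N. 0 < s"
    and int: "\<And>l. 0 < l \<Longrightarrow> integrable N (\<lambda>s. exp (- l * s))" and l: "0 < l"
  shows "integrable N (\<lambda>s. s * exp (- l * s))"
    and "((\<lambda>l. \<integral>s. exp (- l * s) \<partial>N) has_real_derivative - (\<integral>s. s * exp (- l * s) \<partial>N)) (at l)"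
proof -
  \<comment> \<open>The rate \<open>l\<close> is split into four parts: one absorbs the increment
    \<open>\<bar>h\<bar> < \<delta>\<close>, one the factor \<open>s\<^sup>2\<close>, and the
    remaining rate \<open>2 * \<delta>\<close> keeps the bound integrable.\<close>
  define \<delta> where "\<delta> = l / 4"
  have \<delta>: "0 < \<delta>" "l = 4 * \<delta>" using l by (auto simp: \<delta>_def)
  show I: "integrable N (\<lambda>s. s * exp (- l * s))"
  proof (rule Bochner_Integration.integrable_bound)
    show "integrable N (\<lambda>s. (1 / \<delta>) * exp (- (3 * \<delta>) * s))"
      using int[of "3 * \<delta>"] \<delta> by (intro integrable_mult_right) auto
    show "AE s in N. norm (s * exp (- l * s)) \<le> norm ((1 / \<delta>) * exp (- (3 * \<delta>) * s))"
      using pos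
    proof eventually_elim
      case (elim s)
      have "\<delta> * s \<le> exp (\<delta> * s)" using exp_ge_add_one_self[of "\<delta> * s"] by linarith
      then have "s \<le> (1 / \<delta>) * exp (\<delta> * s)" using \<delta> by (simp add: field_simps)
      then have "s * exp (- l * s) \<le> (1 / \<delta>) * exp (\<delta> * s) * exp (- l * s)"
        by (intro mult_right_mono) auto
      also have "\<dots> = (1 / \<delta>) * exp (- (3 * \<delta>) * s)"
        by (simp add: \<delta>(2) mult_exp_exp algebra_simps)
      finally show ?case using elim \<delta> by simp
    qed
  qed measurable
  define L where "L l = (\<integral>s. exp (- l * s) \<partial>N)" for l
  define D where "D = (\<integral>s. s * exp (- l * s) \<partial>N)"
  define K where "K = 2 / \<delta>\<^sup>2 * L (2 * \<delta>)"
  have bound: "\<bar>L (l + h) - L l + h * D\<bar> \<le> h\<^sup>2 * K" if h: "\<bar>h\<bar> < \<delta>" for h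
  proof -
    have lh: "0 < l + h" using h \<delta> by linarith
    note i1 = int[OF lh] and i2 = int[OF l]
    have "L (l + h) - L l + h * D = (\<integral>s. exp (- (l + h) * s) - exp (- l * s) + h * (s * exp (- l * s)) \<partial>N)"
      unfolding L_def D_def using i1 i2 I by simp
    then have "\<bar>L (l + h) - L l + h * D\<bar> =
        \<bar>\<integral>s. exp (- (l + h) * s) - exp (- l * s) + h * (s * exp (- l * s)) \<partial>N\<bar>"
      by (simp only:)
    also have "\<dots> \<le> (\<integral>s. \<bar>exp (- (l + h) * s) - exp (- l * s) + h * (s * exp (- l * s))\<bar> \<partial>N)"
      by (rule integral_abs_bound)
    also have "\<dots> \<le> (\<integral>s. h\<^sup>2 * (2 / \<delta>\<^sup>2 * exp (- (2 * \<delta>) * s)) \<partial>N)"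
    proof (rule integral_mono_AE)
      show "integrable N (\<lambda>s. \<bar>exp (- (l + h) * s) - exp (- l * s) + h * (s * exp (- l * s))\<bar>)"
        by (rule integrable_abs[OF Bochner_Integration.integrable_add[OF
              Bochner_Integration.integrable_diff[OF i1 i2] integrable_mult_right[OF I]]])
      show "integrable N (\<lambda>s. h\<^sup>2 * (2 / \<delta>\<^sup>2 * exp (- (2 * \<delta>) * s)))"
        by (rule integrable_mult_right, rule integrable_mult_right, rule int) (use \<delta> in simp)
      show "AE s in N. \<bar>exp (- (l + h) * s) - exp (- l * s) + h * (s * exp (- l * s))\<bar>
          \<le> h\<^sup>2 * (2 / \<delta>\<^sup>2 * exp (- (2 * \<delta>) * s))"
        using pos
      proof eventually_elim
        case (elim s)
        have "exp (- (l + h) * s) = exp (- l * s) * exp (- (h * s))"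
          unfolding mult_exp_exp by (rule arg_cong[where f=exp]) (simp add: algebra_simps)
        then have "exp (- (l + h) * s) - exp (- l * s) + h * (s * exp (- l * s))
            = exp (- l * s) * (exp (- (h * s)) - 1 - (- (h * s)))"
          by (simp only:) (simp add: algebra_simps)
        then have "\<bar>exp (- (l + h) * s) - exp (- l * s) + h * (s * exp (- l * s))\<bar>
            = \<bar>exp (- l * s) * (exp (- (h * s)) - 1 - (- (h * s)))\<bar>"
          by (simp only:)
        also have "\<dots> = exp (- l * s) * \<bar>exp (- (h * s)) - 1 - (- (h * s))\<bar>"
          by (simp only: abs_mult abs_exp_cancel)
        also have "\<dots> \<le> exp (- l * s) * ((h * s)\<^sup>2 * exp (\<delta> * s))"
        proof (rule mult_left_mono)
          have "\<bar>exp (- (h * s)) - 1 - (- (h * s))\<bar> \<le> (h * s)\<^sup>2 * exp \<bar>h * s\<bar>"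
            using exp_remainder_bound[of "- (h * s)"] by simp
          also have "\<dots> \<le> (h * s)\<^sup>2 * exp (\<delta> * s)"
            using elim h by (intro mult_left_mono) (auto simp: abs_mult)
          finally show "\<bar>exp (- (h * s)) - 1 - (- (h * s))\<bar> \<le> (h * s)\<^sup>2 * exp (\<delta> * s)" .
        qed simp
        also have "\<dots> = h\<^sup>2 * (s\<^sup>2 * exp (- (3 * \<delta>) * s))"
        proof -
          have "exp (- l * s) * exp (\<delta> * s) = exp (- (3 * \<delta>) * s)"
            unfolding mult_exp_exp by (rule arg_cong[where f=exp]) (simp add: \<delta>(2) algebra_simps)
          then show ?thesis by (simp add: power_mult_distrib mult_ac)
        qed
        also have "\<dots> \<le> h\<^sup>2 * (2 / \<delta>\<^sup>2 * exp (\<delta> * s) * exp (- (3 * \<delta>) * s))"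
        proof (intro mult_left_mono mult_right_mono)
          have "(\<delta> * s)\<^sup>2 / 2 \<le> exp (\<delta> * s)"
            using exp_lower_Taylor_quadratic[of "\<delta> * s"] elim \<delta> by (smt (verit) mult_pos_pos)
          then show "s\<^sup>2 \<le> 2 / \<delta>\<^sup>2 * exp (\<delta> * s)"
            using \<delta> by (simp add: field_simps power_mult_distrib)
        qed auto
        also have "\<dots> = h\<^sup>2 * (2 / \<delta>\<^sup>2 * exp (- (2 * \<delta>) * s))"
        proof -
          have "exp (\<delta> * s) * exp (- (3 * \<delta>) * s) = exp (- (2 * \<delta>) * s)"
            unfolding mult_exp_exp by (rule arg_cong[where f=exp]) (simp add: algebra_simps)
          then show ?thesis by (simp add: mult_ac)
        qed
        finally show ?case .
      qed
    qed
    also have "\<dots> = h\<^sup>2 * K"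
      by (simp add: K_def L_def)
    finally show ?thesis .
  qed
  have "((\<lambda>h. (L (l + h) - L l) / h - (- D)) \<longlongrightarrow> 0) (at 0)"
  proof (rule Lim_null_comparison)
    show "\<forall>\<^sub>F h in at 0. norm ((L (l + h) - L l) / h - (- D)) \<le> \<bar>h\<bar> * K"
      unfolding eventually_at
    proof (intro exI[of _ \<delta>] conjI ballI impI)
      fix h :: real assume h: "h \<noteq> 0 \<and> dist h 0 < \<delta>"
      then have "(L (l + h) - L l) / h - (- D) = (L (l + h) - L l + h * D) / h"
        by (simp add: field_simps)
      then have "norm ((L (l + h) - L l) / h - (- D)) = \<bar>L (l + h) - L l + h * D\<bar> / \<bar>h\<bar>"
        by simp
      also have "\<dots> \<le> h\<^sup>2 * K / \<bar>h\<bar>"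
        using h by (intro divide_right_mono bound) auto
      also have "\<dots> = \<bar>h\<bar> * K"
        using h by (simp add: power2_eq_square abs_if)
      finally show "norm ((L (l + h) - L l) / h - (- D)) \<le> \<bar>h\<bar> * K" .
    qed (rule \<delta>(1))
    have "((\<lambda>h. \<bar>h\<bar> * K) \<longlongrightarrow> \<bar>0\<bar> * K) (at (0::real))" by (intro tendsto_intros)
    then show "((\<lambda>h. \<bar>h\<bar> * K) \<longlongrightarrow> 0) (at (0::real))" by simp
  qed
  then have "((\<lambda>h. (L (l + h) - L l) / h) \<longlongrightarrow> - D) (at 0)"
    by (rule LIM_zero_cancel)
  then show "((\<lambda>l. \<integral>s. exp (- l * s) \<partial>N) has_real_derivative - (\<integral>s. s * exp (- l * s) \<partial>N)) (at l)"
    unfolding DERIV_def L_def D_def by simp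
qed

section \<open>Integrals against a decreasing density\<close>

locale decreasing_density =
  fixes u :: "real \<Rightarrow> real" and w :: "real \<Rightarrow> ennreal"
  assumes u_nonneg: "\<And>s. 0 < s \<Longrightarrow> 0 \<le> u s" and u_antimono: "antimono_on {0<..} u"
    and w_eq: "\<And>s. w s = ennreal (u s) * indicator {0<..} s"
begin

lemma measurable_w [measurable]: "w \<in> borel_measurable borel"
proof -
  have "mono_on {0<..} (\<lambda>s. - u s)"
    using u_antimono by (auto simp: monotone_on_def)
  then have "(\<lambda>s. - u s) \<in> borel_measurable (restrict_space borel {0<..})"
    by (rule borel_measurable_mono_on_fnc)
  then have "(\<lambda>s. - (- u s)) \<in> borel_measurable (restrict_space borel {0<..})"
    by (rule borel_measurable_uminus)
  then have "(\<lambda>s. ennreal (u s)) \<in> borel_measurable (restrict_space borel {0<..})"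
    by simp
  then have "(\<lambda>s. ennreal (u s) * indicator {0<..} s) \<in> borel_measurable borel"
    by (subst (asm) borel_measurable_restrict_space_iff_ennreal) auto
  then show ?thesis by (simp add: w_eq cong: measurable_cong)
qed

lemma w_le: "0 < T \<Longrightarrow> T \<le> s \<Longrightarrow> w s \<le> ennreal (u T)"
  using u_antimono by (auto simp: w_eq monotone_on_def intro!: ennreal_leI)

lemma w_ge: "0 < s \<Longrightarrow> s \<le> T \<Longrightarrow> ennreal (u T) \<le> w s"
  using u_antimono by (auto simp: w_eq monotone_on_def intro!: ennreal_leI)

text \<open>Up to \<open>T\<close> the exponential is at most 1. Beyond \<open>T\<close> the density
  is at most \<open>u T\<close>, so the tail contributes at most \<open>u T * T\<close>, which by
  monotonicity is again bounded by the mass up to \<open>T\<close>.\<close>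

lemma laplace_le_initial_mass:
  assumes T: "0 < T"
  shows "(\<integral>\<^sup>+s. w s * ennreal (exp (- (1 / T) * s)) \<partial>lborel) \<le> 2 * (\<integral>\<^sup>+s\<in>{..T}. w s \<partial>lborel)"
proof -
  have tail: "(\<integral>\<^sup>+s. ennreal (exp (- (1 / T) * s)) * indicator {T..} s \<partial>lborel)
      = ennreal (0 - (- T * exp (- (1 / T) * T)))"
  proof (rule nn_integral_FTC_atLeast[where F="\<lambda>s. - T * exp (- (1 / T) * s)"])
    show "((\<lambda>s. - T * exp (- (1 / T) * s)) has_real_derivative exp (- (1 / T) * s)) (at s)" for s
      using T by (auto intro!: derivative_eq_intros)
    show "((\<lambda>s. - T * exp (- (1 / T) * s)) \<longlongrightarrow> 0) at_top"
      by (rule tendsto_mult_exp_minus) (use T in simp)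
  qed auto
  have "ennreal (u T) * ennreal T = (\<integral>\<^sup>+s. ennreal (u T) * indicator {0<..T} s \<partial>lborel)"
    using T by (simp add: nn_integral_cmult_indicator)
  also have "\<dots> \<le> (\<integral>\<^sup>+s\<in>{..T}. w s \<partial>lborel)"
    by (intro nn_integral_mono) (auto simp: indicator_def w_ge)
  finally have UT: "ennreal (u T) * ennreal T \<le> (\<integral>\<^sup>+s\<in>{..T}. w s \<partial>lborel)" .
  have "(\<integral>\<^sup>+s. w s * ennreal (exp (- (1 / T) * s)) \<partial>lborel)
      \<le> (\<integral>\<^sup>+s. w s * indicator {..T} s + ennreal (u T) * (ennreal (exp (- (1 / T) * s)) * indicator {T..} s) \<partial>lborel)"
  proof (rule nn_integral_mono)
    fix s :: real
    show "w s * ennreal (exp (- (1 / T) * s))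
      \<le> w s * indicator {..T} s + ennreal (u T) * (ennreal (exp (- (1 / T) * s)) * indicator {T..} s)"
    proof (cases "s \<le> T")
      case True
      have "w s * ennreal (exp (- (1 / T) * s)) \<le> w s * 1"
      proof (cases "0 < s")
        case True
        then have "exp (- (1 / T) * s) \<le> 1" using T by simp
        then show ?thesis by (intro mult_left_mono) (auto simp: ennreal_le_1)
      qed (simp add: w_eq)
      then show ?thesis using True by (simp add: add_increasing2)
    next
      case False
      then show ?thesis using w_le[OF T, of s] by (simp add: mult_right_mono)
    qed
  qed
  also have "\<dots> = (\<integral>\<^sup>+s\<in>{..T}. w s \<partial>lborel) + ennreal (u T) * ennreal (T * exp (-1))"
    using T tail by (simp add: nn_integral_add nn_integral_cmult)
  also have "ennreal (u T) * ennreal (T * exp (-1)) \<le> ennreal (u T) * ennreal T"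
    using T by (intro mult_left_mono ennreal_leI) (auto simp: mult_le_cancel_left2)
  also note UT
  finally show ?thesis by (simp add: mult_2 add_left_mono)
qed

text \<open>On \<open>(0, T]\<close> the factor \<open>exp (1 - s / T)\<close> is at least 1, which
  gives the first bound. The second follows since \<open>u\<close> is at least \<open>u T\<close>
  there and the integral of \<open>s\<close> over \<open>[0, T]\<close> is half of
  \<open>T\<^sup>2\<close>.\<close>

lemma density_le_laplace_moment:
  assumes T: "0 < T" and J: "J = (\<integral>\<^sup>+s. w s * ennreal (s * exp (- (1 / T) * s)) \<partial>lborel)"
  shows "(\<integral>\<^sup>+s\<in>{0<..T}. w s * ennreal s \<partial>lborel) \<le> ennreal (exp 1) * J"
    and "ennreal (u T) * ennreal (T\<^sup>2) \<le> ennreal (2 * exp 1) * J"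
proof -
  have "(\<integral>\<^sup>+s\<in>{0<..T}. w s * ennreal s \<partial>lborel)
      \<le> (\<integral>\<^sup>+s. ennreal (exp 1) * (w s * ennreal (s * exp (- (1 / T) * s))) \<partial>lborel)"
  proof (rule nn_integral_mono)
    fix s :: real
    have "w s * ennreal s \<le> ennreal (exp 1) * (w s * ennreal (s * exp (- (1 / T) * s)))"
      if s: "0 < s" "s \<le> T"
    proof -
      have "1 \<le> exp (1 - s / T)" using s T by simp
      then have "s \<le> exp 1 * (s * exp (- (1 / T) * s))"
        using s by (simp add: exp_diff exp_minus field_simps)
      then have "ennreal s \<le> ennreal (exp 1) * ennreal (s * exp (- (1 / T) * s))"
        using s by (simp add: ennreal_mult[symmetric] ennreal_leI del: ennreal_le_iff)
      then have "w s * ennreal s \<le> w s * (ennreal (exp 1) * ennreal (s * exp (- (1 / T) * s)))"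
        by (rule mult_left_mono) simp
      then show ?thesis by (simp add: mult_ac)
    qed
    then show "w s * ennreal s * indicator {0<..T} s
        \<le> ennreal (exp 1) * (w s * ennreal (s * exp (- (1 / T) * s)))"
      by (auto simp: indicator_def)
  qed
  also have "\<dots> = ennreal (exp 1) * J"
    unfolding J by (simp add: nn_integral_cmult)
  finally show 1: "(\<integral>\<^sup>+s\<in>{0<..T}. w s * ennreal s \<partial>lborel) \<le> ennreal (exp 1) * J" .
  have half: "(\<integral>\<^sup>+s. ennreal s * indicator {0..T} s \<partial>lborel) = ennreal (T\<^sup>2 / 2 - 0\<^sup>2 / 2)"
    using T by (intro nn_integral_FTC_Icc) (auto intro!: derivative_eq_intros)
  have "ennreal (u T) * ennreal (T\<^sup>2) = 2 * (ennreal (u T) * ennreal (T\<^sup>2 / 2))"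
    using ennreal_mult[of 2 "T\<^sup>2 / 2"] by (simp add: mult_ac)
  also have "ennreal (u T) * ennreal (T\<^sup>2 / 2) = (\<integral>\<^sup>+s. ennreal (u T) * (ennreal s * indicator {0..T} s) \<partial>lborel)"
    using half by (simp add: nn_integral_cmult)
  also have "\<dots> \<le> (\<integral>\<^sup>+s\<in>{0<..T}. w s * ennreal s \<partial>lborel)"
    by (intro nn_integral_mono) (auto simp: indicator_def w_ge intro!: mult_right_mono)
  finally have "ennreal (u T) * ennreal (T\<^sup>2) \<le> 2 * (\<integral>\<^sup>+s\<in>{0<..T}. w s * ennreal s \<partial>lborel)"
    by (simp add: mult_left_mono)
  also have "\<dots> \<le> 2 * (ennreal (exp 1) * J)"
    by (intro mult_left_mono 1) simp
  finally show "ennreal (u T) * ennreal (T\<^sup>2) \<le> ennreal (2 * exp 1) * J"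
    by (simp add: ennreal_mult mult_ac)
qed

text \<open>The integral is split at \<open>T\<close>. The small times give \<open>c1 / T\<close>
  times the truncated first moment; for the large ones \<open>w\<close> is at most
  \<open>u T\<close> and \<open>(T / s) powr (3 / 2)\<close> integrates to \<open>2 * T\<close>.
  Bounding \<open>u T * T\<^sup>2\<close> by \<open>2 * exp 1 * J\<close> turns the resulting factor
  2 into the 4. The exponent 3/2 exceeds 1, so the tail is finite.\<close>

lemma nn_integral_le_laplace_moment:
  assumes T: "0 < T" and J: "J = (\<integral>\<^sup>+s. w s * ennreal (s * exp (- (1 / T) * s)) \<partial>lborel)"
    and c: "0 \<le> c1" "0 \<le> c2"
    and small: "\<And>s. 0 < s \<Longrightarrow> s \<le> T \<Longrightarrow> p s \<le> ennreal (c1 * (s / T))"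
    and large: "\<And>s. T \<le> s \<Longrightarrow> p s \<le> ennreal (c2 * (T / s) powr (3 / 2))"
  shows "(\<integral>\<^sup>+s. w s * p s \<partial>lborel) \<le> ennreal ((c1 + 4 * c2) * exp 1 / T) * J"
proof -
  have tail: "(\<integral>\<^sup>+s. ennreal ((T / s) powr (3 / 2)) * indicator {T..} s \<partial>lborel)
      = ennreal (0 - (- 2 * T powr (3 / 2) * T powr (- 1 / 2)))"
  proof (rule nn_integral_FTC_atLeast[where F="\<lambda>s. - 2 * T powr (3 / 2) * s powr (- 1 / 2)"])
    fix s assume "T \<le> s"
    then have s: "0 < s" using T by simp
    have "(T / s) powr (3 / 2) = T powr (3 / 2) * s powr (- 3 / 2)"
      using T s by (simp add: powr_divide powr_minus field_simps)
    moreover have "((\<lambda>s. - 2 * T powr (3 / 2) * s powr (- 1 / 2)) has_real_derivative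
        - 2 * T powr (3 / 2) * (- 1 / 2 * s powr (- 1 / 2 - 1))) (at s)"
      using s by (intro DERIV_cmult has_real_derivative_powr)
    ultimately show "((\<lambda>s. - 2 * T powr (3 / 2) * s powr (- 1 / 2)) has_real_derivative
        (T / s) powr (3 / 2)) (at s)" by simp
  next
    have "((\<lambda>s. - 2 * T powr (3 / 2) * s powr (- 1 / 2)) \<longlongrightarrow> - 2 * T powr (3 / 2) * 0) at_top"
      by (intro tendsto_intros tendsto_neg_powr filterlim_ident) auto
    then show "((\<lambda>s. - 2 * T powr (3 / 2) * s powr (- 1 / 2)) \<longlongrightarrow> 0) at_top" by simp
  qed auto
  have "T powr (3 / 2) * T powr (- 1 / 2) = T"
    using T by (simp add: powr_add[symmetric])
  then have tail: "(\<integral>\<^sup>+s. ennreal ((T / s) powr (3 / 2)) * indicator {T..} s \<partial>lborel) = ennreal (2 * T)"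
    using tail by (simp add: mult.assoc)
  have "(\<integral>\<^sup>+s. w s * p s \<partial>lborel)
      \<le> (\<integral>\<^sup>+s. ennreal (c1 / T) * (w s * ennreal s * indicator {0<..T} s)
            + ennreal (c2 * u T) * (ennreal ((T / s) powr (3 / 2)) * indicator {T..} s) \<partial>lborel)"
  proof (rule nn_integral_mono)
    fix s :: real
    consider "s \<le> 0" | "0 < s" "s \<le> T" | "T < s" by linarith
    then show "w s * p s \<le> ennreal (c1 / T) * (w s * ennreal s * indicator {0<..T} s)
            + ennreal (c2 * u T) * (ennreal ((T / s) powr (3 / 2)) * indicator {T..} s)"
    proof cases
      case 1
      then show ?thesis by (simp add: w_eq)
    next
      case 2
      have "w s * p s \<le> w s * ennreal (c1 * (s / T))"
        by (intro mult_left_mono small 2) simp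
      also have "ennreal (c1 * (s / T)) = ennreal (c1 / T) * ennreal s"
        using 2 T c by (subst ennreal_mult[symmetric]) (auto simp: field_simps)
      finally show ?thesis using 2 by (simp add: mult_ac add_increasing2)
    next
      case 3
      have "w s * p s \<le> ennreal (u T) * ennreal (c2 * (T / s) powr (3 / 2))"
        using 3 T by (intro mult_mono large w_le) auto
      also have "\<dots> = ennreal (c2 * u T) * ennreal ((T / s) powr (3 / 2))"
        using c u_nonneg[OF T] by (subst (1 2) ennreal_mult[symmetric]) (auto simp: mult_ac)
      finally show ?thesis using 3 by simp
    qed
  qed
  also have "\<dots> = ennreal (c1 / T) * (\<integral>\<^sup>+s\<in>{0<..T}. w s * ennreal s \<partial>lborel)
      + ennreal (c2 * u T) * ennreal (2 * T)"
    by (simp add: nn_integral_add nn_integral_cmult tail)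
  also have "ennreal (c2 * u T) * ennreal (2 * T) = ennreal (2 * c2 / T) * (ennreal (u T) * ennreal (T\<^sup>2))"
    using c T u_nonneg[OF T] by (simp add: ennreal_mult[symmetric] field_simps power2_eq_square)
  also have "ennreal (c1 / T) * (\<integral>\<^sup>+s\<in>{0<..T}. w s * ennreal s \<partial>lborel)
      + ennreal (2 * c2 / T) * (ennreal (u T) * ennreal (T\<^sup>2))
    \<le> ennreal (c1 / T) * (ennreal (exp 1) * J) + ennreal (2 * c2 / T) * (ennreal (2 * exp 1) * J)"
    by (intro add_mono mult_left_mono density_le_laplace_moment[OF T J]) auto
  also have "\<dots> = ennreal ((c1 + 4 * c2) * exp 1 / T) * J"
    using c T
    by (simp add: mult.assoc[symmetric] ennreal_mult[symmetric] distrib_right[symmetric]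
        ennreal_plus[symmetric] del: ennreal_plus)
       (simp add: field_simps)
  finally show ?thesis .
qed

end

section \<open>Hitting estimates\<close>

definition gauss :: "real \<Rightarrow> 'a::euclidean_space \<Rightarrow> real" where
  "gauss s y = (4 * pi * s) powr (- real DIM('a) / 2) * exp (- (norm y)\<^sup>2 / (4 * s))"

lemma emeasure_lborel_ball:
  assumes "0 \<le> r"
  shows "emeasure lborel (ball (c::'a::euclidean_space) r) = ennreal (r ^ DIM('a) * measure lborel (ball (0::'a) 1))"
proof -
  have "emeasure lborel (ball c r) = ennreal (measure lborel (ball c r))"
    by (rule emeasure_eq_ennreal_measure) (use emeasure_lborel_ball_finite[of c r] in auto)
  then show ?thesis using content_ball_conv_unit_ball[OF assms, of c] by simp
qed

text \<open>Raise \<open>a / p \<le> exp (a / p)\<close> to the power \<open>p\<close>. This trades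
  the Gaussian factor for any desired power of the time.\<close>

lemma exp_minus_le_powr:
  fixes a p :: real
  assumes "0 < a" "0 < p"
  shows "exp (- a) \<le> (p / a) powr p"
proof -
  have "a / p \<le> exp (a / p)" using exp_ge_add_one_self[of "a / p"] by linarith
  then have "(a / p) powr p \<le> exp (a / p) powr p"
    using assms by (intro powr_mono2) auto
  also have "\<dots> = exp a" using assms by (simp add: powr_def)
  finally have "1 / exp a \<le> 1 / (a / p) powr p"
    using assms by (intro divide_left_mono) auto
  then show ?thesis using assms by (simp add: exp_minus powr_divide field_simps)
qed

text \<open>The points \<open>dyadic_above n t\<close> decrease to within \<open>1 / 2 ^ n\<close>
  of \<open>t\<close> from the right, so eventually \<open>Y\<close> lies in the open set there.
  Letting \<open>k\<close> run to \<open>4 ^ n\<close> makes the grid of mesh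
  \<open>1 / 2 ^ n\<close> reach up to \<open>2 ^ n\<close>, which eventually exceeds
  \<open>t + 1\<close>.\<close>

lemma right_continuous_exit_approx:
  fixes Y :: "real \<Rightarrow> 'b::topological_space"
  assumes "0 \<le> t" "(Y \<longlongrightarrow> Y t) (at_right t)" "open A" "Y t \<in> A"
  shows "\<exists>n k. k \<le> 4 ^ n \<and> Y (real k * (1 / 2 ^ n)) \<in> A"
proof -
  have "(\<lambda>n. Y (dyadic_above n t)) \<longlonglongrightarrow> Y t"
    by (rule filterlim_compose[OF assms(2) filterlim_dyadic_above[OF assms(1)]])
  then have 1: "\<forall>\<^sub>F n in sequentially. Y (dyadic_above n t) \<in> A"
    using assms(3,4) by (rule topological_tendstoD)
  obtain m where m: "t + 1 < 2 ^ m" using real_arch_pow[of 2 "t + 1"] by auto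
  have 2: "\<forall>\<^sub>F n in sequentially. m \<le> n" by (rule eventually_ge_at_top)
  obtain n where n: "Y (dyadic_above n t) \<in> A" "m \<le> n"
    using eventually_conj[OF 1 2] by (auto simp: eventually_sequentially)
  let ?k = "nat \<lfloor>t * 2 ^ n\<rfloor> + 1"
  have "(2::real) ^ m \<le> 2 ^ n" using n(2) by (rule power_increasing) simp
  then have "t + 1 \<le> 2 ^ n" using m by linarith
  have "real ?k \<le> t * 2 ^ n + 1"
    using dyadic_above_bounds(2)[OF assms(1), of n] by (simp add: dyadic_above_def field_simps)
  also have "\<dots> \<le> t * 2 ^ n + 2 ^ n" by simp
  also have "\<dots> = (t + 1) * 2 ^ n" by (simp add: algebra_simps)
  also have "\<dots> \<le> 2 ^ n * 2 ^ n" using \<open>t + 1 \<le> 2 ^ n\<close> by (intro mult_right_mono) auto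
  also have "\<dots> = real (4 ^ n)" by (simp add: power_mult_distrib[symmetric])
  finally have "?k \<le> 4 ^ n" by (simp only: of_nat_le_iff)
  moreover have "Y (real ?k * (1 / 2 ^ n)) \<in> A"
    using n(1) by (simp add: dyadic_above_def)
  ultimately show ?thesis by blast
qed

locale subordinate_brownian = subordination M S B + decreasing_density u w
  for M :: "'w measure" and S :: "real \<Rightarrow> 'w \<Rightarrow> real" and B :: "real \<Rightarrow> 'w \<Rightarrow> 'a::euclidean_space"
    and u :: "real \<Rightarrow> real" and w :: "real \<Rightarrow> ennreal" +
  fixes \<phi> :: "real \<Rightarrow> real"
  assumes brownian_B: "brownian_motion M B" and dim: "3 \<le> DIM('a)"
    and laplace_S: "laplace_exponent M S \<phi>"
    and potential_S: "\<And>A. A \<in> sets borel \<Longrightarrow> potential M S A = (\<integral>\<^sup>+s\<in>A. w s \<partial>lborel)"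
begin

section \<open>The Laplace transform of the potential density\<close>

text \<open>Otherwise the expectation of \<open>1 - exp (- l * S t)\<close> is at most 0, so
  \<open>S t\<close> vanishes almost surely for every \<open>t\<close>. Then the potential measure
  of the point 0 is infinite, although a measure with a density has no atom.\<close>

lemma laplace_exponent_pos:
  assumes l: "0 < l"
  shows "0 < \<phi> l"
proof (rule ccontr)
  assume "\<not> 0 < \<phi> l"
  have "AE \<omega> in M. SV t \<omega> = 0" if t: "0 \<le> t" for t
  proof -
    have [measurable]: "S t \<in> borel_measurable M" using t by (rule measurable_S)
    have le: "AE \<omega> in M. exp (- l * S t \<omega>) \<le> 1"
      using AE_SV by eventually_elim (use l t in simp)
    have int: "integrable M (\<lambda>\<omega>. exp (- l * S t \<omega>))"
      by (rule integrable_const_bound[where B=1]) (use le in auto)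
    have "(\<integral>\<omega>. (1 - exp (- l * S t \<omega>)) \<partial>M) = 1 - exp (- t * \<phi> l)"
      using int laplace_S l t by (simp add: laplace_exponent_def prob_space)
    also have "\<dots> \<le> 0"
      using \<open>\<not> 0 < \<phi> l\<close> t by (simp add: mult_nonneg_nonpos)
    finally have "(\<integral>\<omega>. (1 - exp (- l * S t \<omega>)) \<partial>M) = 0"
      using integral_nonneg_AE[of "\<lambda>\<omega>. 1 - exp (- l * S t \<omega>)" M] le by force
    then have "AE \<omega> in M. 1 - exp (- l * S t \<omega>) = 0"
      by (subst (asm) integral_nonneg_eq_0_iff_AE) (use int le in auto)
    with AE_SV show ?thesis
      by eventually_elim (use l t in auto)
  qed
  note SV_0 = this
  have "(\<integral>\<^sup>+\<omega>. indicator {0} (SV t \<omega>) \<partial>M) = (1::ennreal)" if "0 \<le> t" for t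
  proof -
    have "(\<integral>\<^sup>+\<omega>. indicator {0} (SV t \<omega>) \<partial>M) = (\<integral>\<^sup>+\<omega>. 1 \<partial>M)"
      by (rule nn_integral_cong_AE, use SV_0[OF that] in eventually_elim) simp
    then show ?thesis by (simp add: emeasure_space_1)
  qed
  then have "(\<integral>\<^sup>+t\<in>{0..}. (\<integral>\<^sup>+\<omega>. indicator {0} (SV t \<omega>) \<partial>M) \<partial>lborel) = (\<integral>\<^sup>+t. indicator {0::real..} t \<partial>lborel)"
    by (intro nn_integral_cong) (auto simp: indicator_def)
  moreover have "(\<integral>\<^sup>+t\<in>{0..}. (\<integral>\<^sup>+\<omega>. indicator {0} (SV t \<omega>) \<partial>M) \<partial>lborel)
      = (\<integral>\<^sup>+s. w s * indicator {0} s \<partial>lborel)"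
    by (rule nn_integral_SV_potential[OF potential_S measurable_w]) auto
  moreover have "w s * indicator {0} s = 0" for s
    by (auto simp: w_eq indicator_def)
  moreover have "emeasure lborel {0::real..} = \<infinity>"
  proof (rule ccontr)
    assume "emeasure lborel {0::real..} \<noteq> \<infinity>"
    then obtain m where m: "0 \<le> m" "emeasure lborel {0::real..} = ennreal m"
      by (cases "emeasure lborel {0::real..}") auto
    have "emeasure lborel {0..m + 1} \<le> emeasure lborel {0::real..}"
      by (rule emeasure_mono) auto
    then show False using m by simp
  qed
  ultimately show False by simp
qed

text \<open>The occupation formula for \<open>exp (- l * s)\<close> reduces the left side to the
  integral of \<open>exp (- t * \<phi> l)\<close> over \<open>t \<ge> 0\<close>, which converges
  because \<open>\<phi> l\<close> is positive.\<close>

lemma laplace_potential: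
  assumes l: "0 < l"
  shows "(\<integral>\<^sup>+s. w s * ennreal (exp (- l * s)) \<partial>lborel) = ennreal (1 / \<phi> l)"
proof -
  have pos: "0 < \<phi> l" using l by (rule laplace_exponent_pos)
  have "(\<integral>\<^sup>+s. w s * ennreal (exp (- l * s)) \<partial>lborel)
      = (\<integral>\<^sup>+t\<in>{0..}. (\<integral>\<^sup>+\<omega>. ennreal (exp (- l * SV t \<omega>)) \<partial>M) \<partial>lborel)"
    by (rule nn_integral_SV_potential[OF potential_S measurable_w, symmetric]) auto
  also have "\<dots> = (\<integral>\<^sup>+t. ennreal (exp (- \<phi> l * t)) * indicator {0..} t \<partial>lborel)"
  proof (rule nn_integral_cong)
    fix t :: real
    have "(\<integral>\<^sup>+\<omega>. ennreal (exp (- l * SV t \<omega>)) \<partial>M) = ennreal (exp (- \<phi> l * t))" if t: "0 \<le> t"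
    proof -
      have [measurable]: "S t \<in> borel_measurable M" using t by (rule measurable_S)
      have le: "AE \<omega> in M. exp (- l * S t \<omega>) \<le> 1"
        using AE_SV by eventually_elim (use l t in simp)
      have int: "integrable M (\<lambda>\<omega>. exp (- l * S t \<omega>))"
        by (rule integrable_const_bound[where B=1]) (use le in auto)
      have "(\<integral>\<^sup>+\<omega>. ennreal (exp (- l * SV t \<omega>)) \<partial>M) = (\<integral>\<^sup>+\<omega>. ennreal (exp (- l * S t \<omega>)) \<partial>M)"
        by (rule nn_integral_cong_AE, use AE_SV in eventually_elim) (use t in simp)
      also have "\<dots> = ennreal (\<integral>\<omega>. exp (- l * S t \<omega>) \<partial>M)"
        by (rule nn_integral_eq_integral[OF int]) simp
      also have "\<dots> = ennreal (exp (- \<phi> l * t))"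
        using laplace_S l t by (simp add: laplace_exponent_def mult.commute)
      finally show ?thesis .
    qed
    then show "(\<integral>\<^sup>+\<omega>. ennreal (exp (- l * SV t \<omega>)) \<partial>M) * indicator {0..} t
        = ennreal (exp (- \<phi> l * t)) * indicator {0..} t"
      by (auto simp: indicator_def)
  qed
  also have "\<dots> = ennreal (0 - (- (1 / \<phi> l) * exp (- \<phi> l * 0)))"
  proof (rule nn_integral_FTC_atLeast[where F="\<lambda>t. - (1 / \<phi> l) * exp (- \<phi> l * t)"])
    show "((\<lambda>t. - (1 / \<phi> l) * exp (- \<phi> l * t)) has_real_derivative exp (- \<phi> l * t)) (at t)" for t
      using pos by (auto intro!: derivative_eq_intros)
    show "((\<lambda>t. - (1 / \<phi> l) * exp (- \<phi> l * t)) \<longlongrightarrow> 0) at_top"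
      by (rule tendsto_mult_exp_minus) (rule pos)
  qed auto
  finally show ?thesis by simp
qed

text \<open>Near \<open>l\<close> the function \<open>\<phi>\<close> is the reciprocal of a
  differentiable Laplace transform, so it is itself differentiable and \<open>deriv \<phi> l\<close>
  is a genuine derivative, equal to the first moment times
  \<open>(\<phi> l)\<^sup>2\<close>.\<close>

lemma laplace_potential_moment:
  assumes l: "0 < l"
  shows "(\<integral>\<^sup>+s. w s * ennreal (s * exp (- l * s)) \<partial>lborel) = ennreal (deriv \<phi> l / (\<phi> l)\<^sup>2)"
    and "0 \<le> deriv \<phi> l"
proof -
  let ?N = "density lborel w"
  have pos: "AE s in ?N. 0 < s"
    by (subst AE_density) (auto simp: w_eq indicator_def)
  have nn: "(\<integral>\<^sup>+s. ennreal (exp (- l * s)) \<partial>?N) = ennreal (1 / \<phi> l)" if "0 < l" for l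
    using laplace_potential[OF that] by (simp add: nn_integral_density)
  have int: "integrable ?N (\<lambda>s. exp (- l * s))" if "0 < l" for l
    by (rule integrableI_nonneg) (use nn[OF that] in auto)
  have L: "(\<integral>s. exp (- l * s) \<partial>?N) = 1 / \<phi> l" if "0 < l" for l
    using nn[OF that] laplace_exponent_pos[OF that]
    by (subst integral_eq_nn_integral) auto
  define D where "D = (\<integral>s. s * exp (- l * s) \<partial>?N)"
  have sets: "sets ?N = sets borel" by simp
  have intD: "integrable ?N (\<lambda>s. s * exp (- l * s))"
    by (rule laplace_transform_DERIV(1)[OF sets pos _ l]) (rule int)
  have der: "((\<lambda>l. \<integral>s. exp (- l * s) \<partial>?N) has_real_derivative - D) (at l)"
    unfolding D_def by (rule laplace_transform_DERIV(2)[OF sets pos _ l]) (rule int)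
  have Dnn: "0 \<le> D"
    unfolding D_def by (rule integral_nonneg_AE) (use pos in eventually_elim, simp)
  have "\<phi> l \<noteq> 0" using laplace_exponent_pos[OF l] by simp
  then have "((\<lambda>l. inverse (\<integral>s. exp (- l * s) \<partial>?N)) has_real_derivative
      - (inverse (1 / \<phi> l) * (- D) * inverse (1 / \<phi> l))) (at l)"
    using DERIV_inverse'[OF der] unfolding L[OF l] by simp
  then have "((\<lambda>l. inverse (\<integral>s. exp (- l * s) \<partial>?N)) has_real_derivative D * (\<phi> l)\<^sup>2) (at l)"
    by (simp add: power2_eq_square mult_ac)
  \<comment> \<open>The identification with \<open>\<phi>\<close> is available only on the positive
    half-line, which is a neighbourhood of \<open>l\<close>.\<close>
  moreover have "\<forall>\<^sub>F x in nhds l. inverse (\<integral>s. exp (- x * s) \<partial>?N) = \<phi> x"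
  proof -
    have "\<forall>\<^sub>F x in nhds l. x \<in> {0<..}"
      by (rule eventually_nhds_in_open) (use l in auto)
    then show ?thesis
    proof eventually_elim
      case (elim x)
      then show ?case using L[of x] by simp
    qed
  qed
  ultimately have "(\<phi> has_real_derivative D * (\<phi> l)\<^sup>2) (at l)"
    by (subst (asm) DERIV_cong_ev[OF refl _ refl]) auto
  then have deriv: "deriv \<phi> l = D * (\<phi> l)\<^sup>2"
    by (rule DERIV_imp_deriv)
  then show "0 \<le> deriv \<phi> l" using Dnn by simp
  have "(\<integral>\<^sup>+s. w s * ennreal (s * exp (- l * s)) \<partial>lborel) = (\<integral>\<^sup>+s. ennreal (s * exp (- l * s)) \<partial>?N)"
    by (simp add: nn_integral_density)
  also have "\<dots> = ennreal D"
    unfolding D_def by (rule nn_integral_eq_integral[OF intD]) (use pos in eventually_elim, simp)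
  also have "D = deriv \<phi> l / (\<phi> l)\<^sup>2"
    using laplace_exponent_pos[OF l] by (simp add: deriv)
  finally show "(\<integral>\<^sup>+s. w s * ennreal (s * exp (- l * s)) \<partial>lborel) = ennreal (deriv \<phi> l / (\<phi> l)\<^sup>2)" .
qed

section \<open>Gaussian probabilities of the shell\<close>

lemma nn_integral_BV:
  assumes s: "0 < s" and [measurable]: "f \<in> borel_measurable borel"
  shows "(\<integral>\<^sup>+\<omega>. f (BV s \<omega>) \<partial>M) = (\<integral>\<^sup>+y. ennreal (gauss s y) * f y \<partial>lborel)"
proof -
  have "distributed M lborel (B s) (\<lambda>y. ennreal (gauss s y))"
    using brownian_B s unfolding brownian_motion_def gauss_def by blast
  then have "(\<integral>\<^sup>+y. ennreal (gauss s y) * f y \<partial>lborel) = (\<integral>\<^sup>+\<omega>. f (B s \<omega>) \<partial>M)"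
    by (rule distributed_nn_integral) simp
  also have "\<dots> = (\<integral>\<^sup>+\<omega>. f (BV s \<omega>) \<partial>M)"
    by (rule nn_integral_cong_AE, use AE_BV in eventually_elim) (use s in simp)
  finally show ?thesis ..
qed

lemma BV_prob_le:
  assumes s: "0 < s" and C[measurable]: "C \<in> sets borel" and "0 \<le> b" "0 \<le> R"
    and le: "\<And>y. z + y \<in> C \<Longrightarrow> norm y < R \<and> gauss s y \<le> b"
  shows "(\<integral>\<^sup>+\<omega>. indicator C (z + BV s \<omega>) \<partial>M) \<le> ennreal (b * (R ^ DIM('a) * measure lborel (ball (0::'a) 1)))"
proof -
  have "(\<integral>\<^sup>+\<omega>. indicator C (z + BV s \<omega>) \<partial>M) = (\<integral>\<^sup>+y. ennreal (gauss s y) * indicator C (z + y) \<partial>lborel)"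
    by (rule nn_integral_BV[OF s]) measurable
  also have "\<dots> \<le> (\<integral>\<^sup>+y. ennreal b * indicator (ball (0::'a) R) y \<partial>lborel)"
    using le by (intro nn_integral_mono) (auto simp: indicator_def intro!: ennreal_leI)
  also have "\<dots> = ennreal (b * (R ^ DIM('a) * measure lborel (ball (0::'a) 1)))"
    using assms by (simp add: nn_integral_cmult_indicator emeasure_lborel_ball ennreal_mult)
  finally show ?thesis .
qed

lemma BV_prob_ge:
  assumes s: "0 < s" and C[measurable]: "C \<in> sets borel" and "0 \<le> b" "0 \<le> R"
    and ge: "\<And>y. norm y < R \<Longrightarrow> z + y \<in> C \<and> b \<le> gauss s y"
  shows "ennreal (b * (R ^ DIM('a) * measure lborel (ball (0::'a) 1))) \<le> (\<integral>\<^sup>+\<omega>. indicator C (z + BV s \<omega>) \<partial>M)"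
proof -
  have "ennreal (b * (R ^ DIM('a) * measure lborel (ball (0::'a) 1))) = (\<integral>\<^sup>+y. ennreal b * indicator (ball (0::'a) R) y \<partial>lborel)"
    using assms by (simp add: nn_integral_cmult_indicator emeasure_lborel_ball ennreal_mult)
  also have "\<dots> \<le> (\<integral>\<^sup>+y. ennreal (gauss s y) * indicator C (z + y) \<partial>lborel)"
    using ge by (intro nn_integral_mono) (auto simp: indicator_def intro!: ennreal_leI)
  also have "\<dots> = (\<integral>\<^sup>+\<omega>. indicator C (z + BV s \<omega>) \<partial>M)"
    by (rule nn_integral_BV[OF s, symmetric]) measurable
  finally show ?thesis .
qed

end

context subordinate_brownian
begin

text \<open>Brownian scaling: the normalisation of the Gaussian density times the volume scale of a
  ball of radius \<open>sqrt T\<close> depends only on \<open>T / s\<close>.\<close>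

lemma powr_scale:
  assumes "0 < s" "0 < T"
  shows "(4 * pi * s) powr (- real DIM('a) / 2) * sqrt T ^ DIM('a)
    = (4 * pi) powr (- real DIM('a) / 2) * (T / s) powr (real DIM('a) / 2)"
proof -
  define a where "a = real DIM('a) / 2"
  have a: "- real DIM('a) / 2 = - a" by (simp add: a_def)
  have "sqrt T ^ DIM('a) = T powr a"
    using assms by (simp add: a_def powr_half_sqrt[symmetric] powr_powr powr_realpow[symmetric])
  moreover have "(4 * pi * s) powr (- a) = (4 * pi) powr (- a) * (1 / s powr a)"
    unfolding powr_mult powr_minus_divide by simp
  moreover have "(T / s) powr a = T powr a / s powr a"
    using assms by (simp add: powr_divide)
  ultimately show ?thesis
    unfolding a a_def[symmetric] by simp
qed

text \<open>Here \<open>2 ^ DIM('a)\<close> comes from a ball of radius \<open>2 * r\<close>, and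
  256 is \<open>4 * 8 ^ 2\<close>: the Brownian displacement is at least \<open>r / 8\<close>, and
  the Gaussian exponent has \<open>4 * s\<close> in the denominator.\<close>

definition inner_const :: real where
  "inner_const = (4 * pi) powr (- real DIM('a) / 2) * 2 ^ DIM('a) * measure lborel (ball (0::'a) 1)
     * (256 * (real DIM('a) / 2 + 1)) powr (real DIM('a) / 2 + 1)"

definition outer_const :: real where
  "outer_const = (4 * pi) powr (- real DIM('a) / 2) * 2 ^ DIM('a) * measure lborel (ball (0::'a) 1)"

text \<open>The volume is that of a ball of radius \<open>sqrt s / 16\<close>, on which the Gaussian
  exponent is at most \<open>(1 / 16)\<^sup>2 / 4\<close>, that is 1/1024.\<close>

definition lower_const :: real where
  "lower_const = (4 * pi) powr (- real DIM('a) / 2) * exp (- (1 / 1024)) * (1 / 16) ^ DIM('a)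
     * measure lborel (ball (0::'a) 1)"

lemma unit_ball_pos: "0 < measure lborel (ball (0::'a) 1)"
  using content_ball_pos[of 1 "0::'a"] by simp

lemma const_nonneg: "0 \<le> inner_const" "0 \<le> outer_const"
  unfolding inner_const_def outer_const_def by auto

lemma lower_const_pos: "0 < lower_const"
  unfolding lower_const_def using unit_ball_pos by simp

context
  fixes r :: real
  assumes r: "0 < r"
begin

text \<open>The ball of radius \<open>r / 16\<close> around a point of \<open>target\<close> lies in \<open>shell\<close>. The sphere of radius
  \<open>r / 2\<close> belongs to the open set \<open>target\<close>, so it does not matter whether the exit is by a jump.\<close>

definition "shell = {y::'a. 3 * r / 8 < norm y \<and> norm y < 9 * r / 8}"

definition "target = {y::'a. 7 * r / 16 < norm y \<and> norm y < r}"

lemma sets_shell [measurable]: "shell \<in> sets borel"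
  unfolding shell_def by measurable

lemma open_target: "open target"
proof -
  have "open ({y::'a. 7 * r / 16 < norm y} \<inter> {y. norm y < r})"
    by (rule open_Int; rule open_Collect_less) (auto intro!: continuous_intros)
  then show ?thesis by (simp add: target_def Collect_conj_eq)
qed

text \<open>The density is bounded by its maximum, and the displacements that lead into the shell
  lie in a ball of radius \<open>2 * r\<close>. Since \<open>r\<^sup>2 / s\<close> is at most 1 and
  the dimension at least 3, the exponent may be lowered to 3/2.\<close>

lemma shell_prob_large_time:
  assumes z: "norm z < r / 4" and s: "r\<^sup>2 \<le> s"
  shows "(\<integral>\<^sup>+\<omega>. indicator shell (z + BV s \<omega>) \<partial>M) \<le> ennreal (outer_const * (r\<^sup>2 / s) powr (3 / 2))"
proof -
  have s0: "0 < s" using s r by (smt (verit) zero_less_power)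
  have "(\<integral>\<^sup>+\<omega>. indicator shell (z + BV s \<omega>) \<partial>M) \<le>
      ennreal ((4 * pi * s) powr (- real DIM('a) / 2) * ((2 * r) ^ DIM('a) * measure lborel (ball (0::'a) 1)))"
  proof (rule BV_prob_le[OF s0])
    fix y assume "z + y \<in> shell"
    then have "norm (z + y) < 9 * r / 8" by (simp add: shell_def)
    then have "norm y < 2 * r"
      using z norm_triangle_ineq4[of "z + y" z] r by simp
    moreover have "gauss s y \<le> (4 * pi * s) powr (- real DIM('a) / 2)"
      unfolding gauss_def using s0 by (intro mult_left_le) auto
    ultimately show "norm y < 2 * r \<and> gauss s y \<le> (4 * pi * s) powr (- real DIM('a) / 2)" ..
  qed (use r in auto)
  also have "(4 * pi * s) powr (- real DIM('a) / 2) * ((2 * r) ^ DIM('a) * measure lborel (ball (0::'a) 1))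
      = outer_const * (r\<^sup>2 / s) powr (real DIM('a) / 2)"
    using powr_scale[OF s0, of "r\<^sup>2"] r by (simp add: outer_const_def power_mult_distrib mult_ac)
  also have "ennreal \<dots> \<le> ennreal (outer_const * (r\<^sup>2 / s) powr (3 / 2))"
  proof (intro ennreal_leI mult_left_mono)
    show "(r\<^sup>2 / s) powr (real DIM('a) / 2) \<le> (r\<^sup>2 / s) powr (3 / 2)"
      using dim s s0 r by (intro powr_mono') auto
  qed (rule const_nonneg)
  finally show ?thesis .
qed

text \<open>Reaching the shell from the inner ball takes a displacement of more than
  \<open>r / 8\<close>, so the Gaussian factor beats every power of
  \<open>s / r\<^sup>2\<close>.\<close>

lemma shell_prob_small_time:
  assumes z: "norm z < r / 4" and s: "0 < s"
  shows "(\<integral>\<^sup>+\<omega>. indicator shell (z + BV s \<omega>) \<partial>M) \<le> ennreal (inner_const * (s / r\<^sup>2))"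
proof -
  \<comment> \<open>The normalisation of the density consumes \<open>DIM('a) / 2\<close> powers of
    \<open>s / r\<^sup>2\<close>; the extra 1 leaves exactly the linear factor.\<close>
  let ?p = "real DIM('a) / 2 + 1"
  let ?b = "(4 * pi * s) powr (- real DIM('a) / 2) * (256 * ?p * (s / r\<^sup>2)) powr ?p"
  have "(\<integral>\<^sup>+\<omega>. indicator shell (z + BV s \<omega>) \<partial>M) \<le>
      ennreal (?b * ((2 * r) ^ DIM('a) * measure lborel (ball (0::'a) 1)))"
  proof (rule BV_prob_le[OF s])
    fix y assume "z + y \<in> shell"
    then have zy: "norm (z + y) < 9 * r / 8" "3 * r / 8 < norm (z + y)" by (simp_all add: shell_def)
    have le_2r: "norm y < 2 * r"
      using z zy norm_triangle_ineq4[of "z + y" z] r by simp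
    have "r / 8 < norm y"
      using z zy norm_triangle_ineq[of z y] by linarith
    then have y: "(r / 8)\<^sup>2 \<le> (norm y)\<^sup>2" "0 < norm y"
      using r by (auto intro!: power_mono)
    have eq: "?p / ((r / 8)\<^sup>2 / (4 * s)) = 256 * ?p * (s / r\<^sup>2)"
      using r s by (simp add: field_simps power2_eq_square)
    have "exp (- ((norm y)\<^sup>2 / (4 * s))) \<le> (?p / ((norm y)\<^sup>2 / (4 * s))) powr ?p"
      using y s by (intro exp_minus_le_powr) auto
    also have "\<dots> \<le> (?p / ((r / 8)\<^sup>2 / (4 * s))) powr ?p"
      using y s r by (intro powr_mono2 divide_left_mono divide_right_mono) auto
    finally have "exp (- ((norm y)\<^sup>2 / (4 * s))) \<le> (256 * ?p * (s / r\<^sup>2)) powr ?p"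
      unfolding eq .
    then have "gauss s y \<le> ?b"
      unfolding gauss_def by (intro mult_left_mono) auto
    with le_2r show "norm y < 2 * r \<and> gauss s y \<le> ?b" ..
  qed (use r in auto)
  also have "?b * ((2 * r) ^ DIM('a) * measure lborel (ball (0::'a) 1))
      = inner_const * ((r\<^sup>2 / s) powr (real DIM('a) / 2) * (s / r\<^sup>2) powr ?p)"
  proof -
    have "(256 * ?p * (s / r\<^sup>2)) powr ?p = (256 * ?p) powr ?p * (s / r\<^sup>2) powr ?p"
      by (rule powr_mult)
    then show ?thesis
      using powr_scale[OF s, of "r\<^sup>2"] r by (simp only: inner_const_def power_mult_distrib) (simp add: mult_ac)
  qed
  also have "(r\<^sup>2 / s) powr (real DIM('a) / 2) * (s / r\<^sup>2) powr ?p = s / r\<^sup>2"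
  proof -
    have "(s / r\<^sup>2) powr ?p = (s / r\<^sup>2) powr (real DIM('a) / 2) * (s / r\<^sup>2)"
      using r s by (simp add: powr_add)
    moreover have "(r\<^sup>2 / s) powr (real DIM('a) / 2) * (s / r\<^sup>2) powr (real DIM('a) / 2) = 1"
      using r s by (simp add: powr_mult[symmetric])
    ultimately show ?thesis by simp
  qed
  finally show ?thesis .
qed

text \<open>For \<open>s \<le> r\<^sup>2\<close> a displacement below \<open>sqrt s / 16\<close>
  stays within \<open>r / 16\<close> and hence leads from the target into the shell. By scaling, the
  probability of such a displacement does not depend on \<open>s\<close>, and it is at least the
  constant.\<close>

lemma shell_prob_lower:
  assumes z: "z \<in> target" and s: "0 < s" "s \<le> r\<^sup>2"
  shows "ennreal lower_const \<le> (\<integral>\<^sup>+\<omega>. indicator shell (z + BV s \<omega>) \<partial>M)"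
proof -
  let ?b = "(4 * pi * s) powr (- real DIM('a) / 2) * exp (- (1 / 1024))"
  have "sqrt s \<le> r" using s r by (simp add: real_le_lsqrt)
  have "ennreal (?b * ((sqrt s / 16) ^ DIM('a) * measure lborel (ball (0::'a) 1)))
      \<le> (\<integral>\<^sup>+\<omega>. indicator shell (z + BV s \<omega>) \<partial>M)"
  proof (rule BV_prob_ge[OF s(1)])
    fix y :: 'a assume y: "norm y < sqrt s / 16"
    have "norm z - norm y \<le> norm (z + y)" "norm (z + y) \<le> norm z + norm y"
      by (rule norm_diff_ineq, rule norm_triangle_ineq)
    then have "z + y \<in> shell"
      using y z \<open>sqrt s \<le> r\<close> r by (simp add: shell_def target_def)
    moreover have "(norm y)\<^sup>2 \<le> (sqrt s / 16)\<^sup>2"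
      using y by (intro power_mono) auto
    then have "(norm y)\<^sup>2 / (4 * s) \<le> 1 / 1024"
      using s by (simp add: field_simps power_divide)
    then have "?b \<le> gauss s y"
      unfolding gauss_def by (intro mult_left_mono) auto
    ultimately show "z + y \<in> shell \<and> ?b \<le> gauss s y" ..
  qed (use s in auto)
  also have "?b * ((sqrt s / 16) ^ DIM('a) * measure lborel (ball (0::'a) 1)) = lower_const"
    using powr_scale[OF s(1) s(1)] s(1)
    by (simp add: lower_const_def power_divide divide_simps)
  finally show ?thesis .
qed

section \<open>Two-sided bounds for the potential of the shell\<close>

text \<open>The two regimes of the shell probability are the hypotheses of
  \<open>nn_integral_le_laplace_moment\<close> for \<open>T = r\<^sup>2\<close>, and the moment at
  \<open>1 / r\<^sup>2\<close> is the derivative quotient.\<close>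

lemma Green_shell_upper:
  assumes z: "norm z < r / 4"
  shows "Green (indicator shell) z \<le>
    ennreal ((inner_const + 4 * outer_const) * exp 1 / r\<^sup>2 * (deriv \<phi> (1 / r\<^sup>2) / (\<phi> (1 / r\<^sup>2))\<^sup>2))"
proof -
  have T: "0 < r\<^sup>2" "0 < 1 / r\<^sup>2" using r by auto
  have "Green (indicator shell) z = (\<integral>\<^sup>+s. w s * (\<integral>\<^sup>+\<omega>. indicator shell (z + BV s \<omega>) \<partial>M) \<partial>lborel)"
    by (rule Green_eq[OF potential_S measurable_w]) auto
  also have "\<dots> \<le> ennreal ((inner_const + 4 * outer_const) * exp 1 / r\<^sup>2)
      * (\<integral>\<^sup>+s. w s * ennreal (s * exp (- (1 / r\<^sup>2) * s)) \<partial>lborel)"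
    by (rule nn_integral_le_laplace_moment[OF T(1) refl const_nonneg])
       (use shell_prob_small_time[OF z] shell_prob_large_time[OF z] in auto)
  also have "\<dots> = ennreal ((inner_const + 4 * outer_const) * exp 1 / r\<^sup>2 * (deriv \<phi> (1 / r\<^sup>2) / (\<phi> (1 / r\<^sup>2))\<^sup>2))"
    unfolding laplace_potential_moment(1)[OF T(2)]
    using const_nonneg laplace_potential_moment(2)[OF T(2)] by (subst ennreal_mult) auto
  finally show ?thesis .
qed

text \<open>Only the operational times \<open>s \<le> r\<^sup>2\<close> are counted. There the shell
  probability is bounded below, and the mass of \<open>w\<close> up to \<open>r\<^sup>2\<close> is
  at least half of its Laplace transform at \<open>1 / r\<^sup>2\<close>.\<close>

lemma Green_shell_lower:
  assumes z: "z \<in> target"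
  shows "ennreal (lower_const / (2 * \<phi> (1 / r\<^sup>2))) \<le> Green (indicator shell) z"
proof -
  have T: "0 < r\<^sup>2" "0 < 1 / r\<^sup>2" using r by auto
  have pos: "0 < \<phi> (1 / r\<^sup>2)" by (rule laplace_exponent_pos[OF T(2)])
  have "ennreal (1 / (2 * \<phi> (1 / r\<^sup>2))) = ennreal (1 / 2) * ennreal (1 / \<phi> (1 / r\<^sup>2))"
    using pos by (subst ennreal_mult[symmetric]) auto
  also have "\<dots> \<le> ennreal (1 / 2) * (2 * (\<integral>\<^sup>+s\<in>{..r\<^sup>2}. w s \<partial>lborel))"
    using laplace_le_initial_mass[OF T(1)] laplace_potential[OF T(2)]
    by (intro mult_left_mono) auto
  also have "\<dots> = (\<integral>\<^sup>+s\<in>{..r\<^sup>2}. w s \<partial>lborel)"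
    using ennreal_mult[of "1 / 2" 2] by (simp add: mult.assoc[symmetric])
  finally have mass: "ennreal (1 / (2 * \<phi> (1 / r\<^sup>2))) \<le> (\<integral>\<^sup>+s\<in>{..r\<^sup>2}. w s \<partial>lborel)" .
  have "ennreal (lower_const / (2 * \<phi> (1 / r\<^sup>2))) = ennreal lower_const * ennreal (1 / (2 * \<phi> (1 / r\<^sup>2)))"
    using lower_const_pos pos by (subst ennreal_mult[symmetric]) auto
  also have "\<dots> \<le> ennreal lower_const * (\<integral>\<^sup>+s\<in>{..r\<^sup>2}. w s \<partial>lborel)"
    by (intro mult_left_mono mass) simp
  also have "\<dots> = (\<integral>\<^sup>+s. ennreal lower_const * (w s * indicator {..r\<^sup>2} s) \<partial>lborel)"
    by (simp add: nn_integral_cmult)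
  also have "\<dots> \<le> (\<integral>\<^sup>+s. w s * (\<integral>\<^sup>+\<omega>. indicator shell (z + BV s \<omega>) \<partial>M) \<partial>lborel)"
  proof (rule nn_integral_mono)
    fix s :: real
    show "ennreal lower_const * (w s * indicator {..r\<^sup>2} s)
        \<le> w s * (\<integral>\<^sup>+\<omega>. indicator shell (z + BV s \<omega>) \<partial>M)"
    proof (cases "0 < s \<and> s \<le> r\<^sup>2")
      case True
      then have "w s * ennreal lower_const \<le> w s * (\<integral>\<^sup>+\<omega>. indicator shell (z + BV s \<omega>) \<partial>M)"
        by (intro mult_left_mono shell_prob_lower z) auto
      then show ?thesis using True by (simp add: mult.commute)
    qed (auto simp: w_eq indicator_def)
  qed
  also have "\<dots> = Green (indicator shell) z"
    by (rule Green_eq[OF potential_S measurable_w, symmetric]) auto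
  finally show ?thesis .
qed

text \<open>The upper bound for the potential at \<open>x\<close> is divided by the lower bound on
  the target, which cancels one factor \<open>\<phi> (1 / r\<^sup>2)\<close>. The estimate is
  uniform in \<open>n\<close>, and the events increase with \<open>n\<close>, so it passes to their
  union.\<close>

lemma target_hitting_prob:
  assumes x: "norm x < r / 4"
  shows "emeasure M (\<Union>n. {\<omega>\<in>space M. \<exists>k\<le>4 ^ n. x + X (real k * (1 / 2 ^ n)) \<omega> \<in> target})
    \<le> ennreal (2 * exp 1 * (inner_const + 4 * outer_const) / lower_const
        * (1 / r\<^sup>2 * deriv \<phi> (1 / r\<^sup>2) / \<phi> (1 / r\<^sup>2)))"
proof -
  let ?H = "\<lambda>n. {\<omega>\<in>space M. \<exists>k\<le>4 ^ n. x + X (real k * (1 / 2 ^ n)) \<omega> \<in> target}"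
  let ?\<phi> = "\<phi> (1 / r\<^sup>2)"
  have pos: "0 < ?\<phi>" using r by (intro laplace_exponent_pos) auto
  have [measurable]: "target \<in> sets borel" using open_target by (rule borel_open)
  have Hm: "?H n \<in> sets M" for n by measurable
  have "incseq ?H"
  proof (rule incseq_SucI, safe)
    fix n k \<omega> assume k: "k \<le> 4 ^ n" "x + X (real k * (1 / 2 ^ n)) \<omega> \<in> target"
    then show "\<exists>k\<le>4 ^ Suc n. x + X (real k * (1 / 2 ^ Suc n)) \<omega> \<in> target"
      \<comment> \<open>The same time has index \<open>2 * k\<close> on the next grid, and
        \<open>2 * k\<close> is still at most \<open>4 ^ Suc n\<close>.\<close>
      by (intro exI[of _ "2 * k"]) auto
  qed
  then have sup: "emeasure M (\<Union>n. ?H n) = (SUP n. emeasure M (?H n))"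
    using Hm by (intro SUP_emeasure_incseq[symmetric]) auto
  let ?g = "(inner_const + 4 * outer_const) * exp 1 / r\<^sup>2 * (deriv \<phi> (1 / r\<^sup>2) / ?\<phi>\<^sup>2)"
  have g: "0 \<le> ?g"
    using const_nonneg laplace_potential_moment(2)[of "1 / r\<^sup>2"] r by (intro mult_nonneg_nonneg divide_nonneg_nonneg) auto
  have "emeasure M (?H n) \<le> ennreal (?g / (lower_const / (2 * ?\<phi>)))" for n
  proof -
    have "ennreal (lower_const / (2 * ?\<phi>)) * emeasure M (?H n) \<le> Green (indicator shell) x"
      by (rule X_hitting_bound) (auto intro: Green_shell_lower)
    also have "\<dots> \<le> ennreal ?g" by (rule Green_shell_upper[OF x])
    finally have "ennreal (lower_const / (2 * ?\<phi>)) * ennreal (prob (?H n)) \<le> ennreal ?g"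
      by (simp add: emeasure_eq_measure)
    then have "lower_const / (2 * ?\<phi>) * prob (?H n) \<le> ?g"
      using g lower_const_pos pos by (subst (asm) ennreal_mult[symmetric]) auto
    then have "prob (?H n) \<le> ?g / (lower_const / (2 * ?\<phi>))"
      using lower_const_pos pos by (subst pos_le_divide_eq) (auto simp: mult.commute)
    then show ?thesis by (simp add: emeasure_eq_measure ennreal_leI)
  qed
  then have "emeasure M (\<Union>n. ?H n) \<le> ennreal (?g / (lower_const / (2 * ?\<phi>)))"
    unfolding sup by (rule SUP_least)
  also have "?g / (lower_const / (2 * ?\<phi>)) = 2 * exp 1 * (inner_const + 4 * outer_const) / lower_const
        * (1 / r\<^sup>2 * deriv \<phi> (1 / r\<^sup>2) / ?\<phi>)"
  proof -
    have "K * e / T * (d / f\<^sup>2) / (l / (2 * f)) = 2 * e * K / l * (1 / T * d / f)"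
      if "0 < f" for K e T d f l :: real
      using that by (simp add: field_simps power2_eq_square)
    then show ?thesis using pos .
  qed
  finally show ?thesis .
qed

section \<open>From the exit event to hitting on dyadic grids\<close>

text \<open>Continuity of \<open>B\<close> and right-continuity of \<open>S\<close> make the path
  right-continuous, and the annulus is contained in the open \<open>target\<close>. A path that is
  in the annulus at its exit time is therefore in \<open>target\<close> at some dyadic time shortly
  afterwards.\<close>

lemma AE_exit_imp_hit:
  "AE \<omega> in M. exit_time (subordinate_bm B S x) (ball 0 (r / 2)) \<omega> < \<infinity> \<and>
      subordinate_bm B S x (real_of_ereal (exit_time (subordinate_bm B S x) (ball 0 (r / 2)) \<omega>)) \<omega>
        \<in> ball 0 r - ball 0 (r / 2) \<longrightarrow>
      (\<exists>n k. k \<le> 4 ^ n \<and> x + X (real k * (1 / 2 ^ n)) \<omega> \<in> target)"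
proof -
  have "AE \<omega> in M. cadlag (\<lambda>t. S t \<omega>)" "AE \<omega> in M. continuous_on {0..} (\<lambda>t. B t \<omega>)"
    using levy_S brownian_B by (auto simp: levy_process_def brownian_motion_def)
  with AE_SV AE_BV show ?thesis
  proof eventually_elim
    case (elim \<omega>)
    define Y where "Y t = subordinate_bm B S x t \<omega>" for t
    define \<tau> where "\<tau> = exit_time (subordinate_bm B S x) (ball 0 (r / 2)) \<omega>"
    have YX: "x + X t \<omega> = Y t" if "0 \<le> t" for t
      using elim(1,2) that by (simp add: X_def Y_def subordinate_bm_def)
    have "\<exists>n k. k \<le> 4 ^ n \<and> x + X (real k * (1 / 2 ^ n)) \<omega> \<in> target"
      if "Y (real_of_ereal \<tau>) \<in> ball 0 r - ball 0 (r / 2)"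
    proof -
      \<comment> \<open>An infinite exit time is sent to 0 by \<open>real_of_ereal\<close>, so the
        real time is nonnegative in every case.\<close>
      have "0 \<le> \<tau>"
        unfolding \<tau>_def exit_time_def by (rule Inf_greatest) auto
      then have t: "0 \<le> real_of_ereal \<tau>" by (rule real_of_ereal_pos)
      let ?t = "real_of_ereal \<tau>"
      have St: "((\<lambda>t. S t \<omega>) \<longlongrightarrow> S ?t \<omega>) (at_right ?t)"
        using elim(3) t by (simp add: cadlag_def)
      have "\<forall>\<^sub>F s in at_right ?t. ?t < s" by (simp add: eventually_at_right_less)
      then have "\<forall>\<^sub>F s in at_right ?t. S s \<omega> \<in> {0..}"
        by eventually_elim (use elim(1) t in auto)
      then have "((\<lambda>s. B (S s \<omega>) \<omega>) \<longlongrightarrow> B (S ?t \<omega>) \<omega>) (at_right ?t)"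
        using elim(1) t by (intro continuous_on_tendsto_compose[OF elim(4) St]) auto
      then have "(Y \<longlongrightarrow> Y ?t) (at_right ?t)"
        unfolding Y_def subordinate_bm_def by (intro tendsto_add tendsto_const)
      moreover have "Y ?t \<in> target"
        using that r by (auto simp: target_def)
      ultimately obtain n k where "k \<le> 4 ^ n" "Y (real k * (1 / 2 ^ n)) \<in> target"
        using right_continuous_exit_approx[OF t _ open_target] by blast
      then show ?thesis
        using YX[of "real k * (1 / 2 ^ n)"] by (intro exI[of _ n] exI[of _ k]) simp
    qed
    then show ?case unfolding Y_def \<tau>_def by blast
  qed
qed

lemma exit_prob_le:
  assumes x: "norm x < r / 4"
  shows "exit_prob M (subordinate_bm B S x) (ball 0 (r / 2)) (ball 0 r - ball 0 (r / 2))
    \<le> 2 * exp 1 * (inner_const + 4 * outer_const) / lower_const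
        * (1 / r\<^sup>2 * deriv \<phi> (1 / r\<^sup>2) / \<phi> (1 / r\<^sup>2))"
proof -
  let ?H = "\<Union>n. {\<omega>\<in>space M. \<exists>k\<le>4 ^ n. x + X (real k * (1 / 2 ^ n)) \<omega> \<in> target}"
  let ?E = "{\<omega>\<in>space M. exit_time (subordinate_bm B S x) (ball 0 (r / 2)) \<omega> < \<infinity> \<and>
      subordinate_bm B S x (real_of_ereal (exit_time (subordinate_bm B S x) (ball 0 (r / 2)) \<omega>)) \<omega>
        \<in> ball 0 r - ball 0 (r / 2)}"
  let ?c = "2 * exp 1 * (inner_const + 4 * outer_const) / lower_const
        * (1 / r\<^sup>2 * deriv \<phi> (1 / r\<^sup>2) / \<phi> (1 / r\<^sup>2))"
  have [measurable]: "target \<in> sets borel" using open_target by (rule borel_open)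
  have H: "?H \<in> sets M" by measurable
  have c: "0 \<le> ?c"
    using const_nonneg lower_const_pos laplace_potential_moment(2)[of "1 / r\<^sup>2"]
      laplace_exponent_pos[of "1 / r\<^sup>2"] r
    by (intro mult_nonneg_nonneg divide_nonneg_nonneg) auto
  \<comment> \<open>The comparison with \<open>?H\<close> holds up to a null set. It is made in the
    completion, and monotonicity requires measurability of the larger event \<open>?H\<close>
    only.\<close>
  have "emeasure (completion M) ?E \<le> emeasure (completion M) ?H"
  proof (rule emeasure_mono_AE)
    have "AE \<omega> in M. \<omega> \<in> ?E \<longrightarrow> \<omega> \<in> ?H"
      using AE_exit_imp_hit[of x] by eventually_elim auto
    then show "AE \<omega> in completion M. \<omega> \<in> ?E \<longrightarrow> \<omega> \<in> ?H" by (rule AE_completion)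
  qed (use H in simp)
  also have "\<dots> = emeasure M ?H" using H by simp
  also have "\<dots> \<le> ennreal ?c" by (rule target_hitting_prob[OF x])
  finally show ?thesis
    unfolding exit_prob_def measure_def using c by (intro enn2real_leI) auto
qed

end

end

theorem proposition1p2:
  fixes M :: "'w measure"
    and S :: "real \<Rightarrow> 'w \<Rightarrow> real"
    and B :: "real \<Rightarrow> 'w \<Rightarrow> 'a::euclidean_space"
    and \<phi> :: "real \<Rightarrow> real" and \<gamma> \<alpha> :: real and \<mu> :: "real measure"
  assumes dim: "DIM('a) \<ge> 3"
    and S: "subordinator M S"
    and phi: "laplace_exponent M S \<phi>"
    and mu: "drift_and_levy_measure \<phi> \<gamma> \<mu>"
    and mu_density: "has_decreasing_density (emeasure \<mu>)"
    and U_density: "has_decreasing_density (potential M S)"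
    and alpha: "0 \<le> \<alpha>" "\<alpha> < 1"
    and deriv_phi: "\<And>x. x > 0 \<Longrightarrow>
      ((\<lambda>l. deriv \<phi> (l * x) / deriv \<phi> l) \<longlongrightarrow> x powr (\<alpha> / 2 - 1)) at_top"
    and B: "brownian_motion M B"
    and indep: "indep_processes M B S"
  shows "\<exists>c>0. \<forall>r\<in>{0<..<1}. \<forall>x\<in>ball 0 (r / 4).
    exit_prob M (subordinate_bm B S x) (ball 0 (r / 2)) (ball 0 r - ball 0 (r / 2))
      \<le> c * (r powi (-2) * deriv \<phi> (r powi (-2)) / \<phi> (r powi (-2)))"
proof -
  obtain u where u: "\<And>t. 0 < t \<Longrightarrow> 0 \<le> u t" "antimono_on {0<..} u"
    and pot: "\<And>A. A \<in> sets borel \<Longrightarrow> potential M S A = (\<integral>\<^sup>+t\<in>A \<inter> {0<..}. ennreal (u t) \<partial>lborel)"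
    using U_density unfolding has_decreasing_density_def by blast
  define w where "w s = ennreal (u s) * indicator {0<..} s" for s
  have levy: "levy_process M B" using B by (simp add: brownian_motion_def)
  interpret prob_space M using levy by (simp add: levy_process_def)
  interpret subordinate_brownian M S B u w \<phi>
  proof unfold_locales
    show "potential M S A = (\<integral>\<^sup>+s\<in>A. w s \<partial>lborel)" if "A \<in> sets borel" for A
      unfolding pot[OF that] w_def by (intro nn_integral_cong) (auto simp: indicator_def)
  qed (fact S levy indep u B dim phi | simp add: w_def)+
  \<comment> \<open>This constant depends on the dimension alone.\<close>
  let ?c = "2 * exp 1 * (inner_const + 4 * outer_const) / lower_const"
  have "0 < ?c"
    using const_nonneg(1) lower_const_pos unit_ball_pos
    by (intro divide_pos_pos mult_pos_pos add_nonneg_pos) (auto simp: outer_const_def)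
  moreover have "exit_prob M (subordinate_bm B S x) (ball 0 (r / 2)) (ball 0 r - ball 0 (r / 2))
      \<le> ?c * (r powi (-2) * deriv \<phi> (r powi (-2)) / \<phi> (r powi (-2)))"
    if "r \<in> {0<..<1}" "x \<in> ball 0 (r / 4)" for r x
  proof -
    have "r powi (-2) = 1 / r\<^sup>2" by (simp add: power_int_minus divide_inverse)
    then show ?thesis using exit_prob_le[of r x] that by simp
  qed
  ultimately show ?thesis by blast
qed

end
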